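(* There is a representation $\rho$ of the Yokonuma-Hecke algebra $\mathcal{Y}_{r,n}(q)$ on $V^{\otimes n}$ (operators written on the right) given by $t_i\mapsto \mathbf{T}_i$ for $1\le i\le n$ and $g_i\mapsto \mathbf{G}_i$ for $1\le i\le n-1$.
   Context: Let $n,r\ge 1$ be integers, $\xi=e^{2\pi i/r}\in\mathbb{C}$, $\Delta=\prod_{0\le i<j\le r-1}(\xi^i-\xi^j)$, $q$ an indeterminate and $R=\mathbb{Z}[q,q^{-1},\xi,r^{-1},\Delta^{-1}]$. The symmetric group $\mathfrak{S}_n$ acts on the right on $\{1,\dots,n\}$ (products are composed from left to right) and $s_i=(i,i+1)$. The Yokonuma-Hecke algebra $\mathcal{Y}_{r,n}(q)$ is the associative unital $R$-algebra generated by $g_1,\dots,g_{n-1},t_1,\dots,t_n$ with relations: $t_i^r=1$; $t_it_j=t_jt_i$; $t_jg_i=g_it_{js_i}$ for all $i,j$; $g_ig_j=g_jg_i$ for $|i-j|>1$; $g_ig_{i+1}g_i=g_{i+1}g_ig_{i+1}$; and $g_i^2=1+(q-q^{-1})e_ig_i$, where $e_i=\frac1r\sum_{s=0}^{r-1}t_i^st_{i+1}^{-s}$. Let $V$ be the free $R$-module with basis $\{v_i^t\mid 1\le i\le n,\ 0\le t\le r-1\}$. Define $\mathbf{T}\in\mathrm{End}_R(V)$ and $\mathbf{G}\in\mathrm{End}_R(V^{\otimes 2})$, written on the right, by $(v_i^t)\mathbf{T}=\xi^tv_i^t$ and $$(v_i^t\otimes v_j^s)\mathbf{G}=\begin{cases}v_j^s\otimes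 v_i^t& t\ne s\\ q\,v_i^t\otimes v_j^s& t=s,\ i=j\\ v_j^s\otimes v_i^t& t=s,\ i>j\\ (q-q^{-1})v_i^t\otimes v_j^s+v_j^s\otimes v_i^t& t=s,\ i<j.\end{cases}$$ $\mathbf{T}_i$ is the operator on $V^{\otimes n}$ acting as $\mathbf{T}$ in the $i$-th factor and as the identity elsewhere; $\mathbf{G}_i$ acts as $\mathbf{G}$ in the $i$-th and $(i+1)$-st factors and as the identity elsewhere. Since operators are written on the right, a product $XY$ means first apply $X$, then $Y$. *)

theory Defs
  imports
    "HOL-Algebra.Generated_Rings"
    "HOL-Algebra.QuotRing"
    "HOL-Algebra.Algebraic_Closure_Type"
    "HOL-Combinatorics.Transposition"
begin

section \<open>Associative unital algebras and right representations\<close>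

text \<open>The locale \<^locale>\<open>algebra\<close> of the library is restricted to commutative algebras.\<close>

locale unital_algebra = module R A + ring A for R (structure) and A (structure) +
  assumes smult_mult_left: "\<lbrakk>a \<in> carrier R; x \<in> carrier A; y \<in> carrier A\<rbrakk>
      \<Longrightarrow> (a \<odot>\<^bsub>A\<^esub> x) \<otimes>\<^bsub>A\<^esub> y = a \<odot>\<^bsub>A\<^esub> (x \<otimes>\<^bsub>A\<^esub> y)"
    and smult_mult_right: "\<lbrakk>a \<in> carrier R; x \<in> carrier A; y \<in> carrier A\<rbrakk>
      \<Longrightarrow> x \<otimes>\<^bsub>A\<^esub> (a \<odot>\<^bsub>A\<^esub> y) = a \<odot>\<^bsub>A\<^esub> (x \<otimes>\<^bsub>A\<^esub> y)"

definition algebra_hom ::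
    "('a, 'k) ring_scheme \<Rightarrow> ('a, 'b, 'l) module_scheme \<Rightarrow> ('a, 'c, 'm) module_scheme \<Rightarrow> ('b \<Rightarrow> 'c) set"
  where "algebra_hom R A B =
    {h \<in> ring_hom A B. \<forall>a\<in>carrier R. \<forall>x\<in>carrier A. h (a \<odot>\<^bsub>A\<^esub> x) = a \<odot>\<^bsub>B\<^esub> h x}"

definition linear_maps ::
    "('a, 'k) ring_scheme \<Rightarrow> ('a, 'b, 'l) module_scheme \<Rightarrow> ('a, 'c, 'm) module_scheme \<Rightarrow> ('b \<Rightarrow> 'c) set"
  where "linear_maps R M N =
    {f \<in> carrier M \<rightarrow>\<^sub>E carrier N.
       (\<forall>x\<in>carrier M. \<forall>y\<in>carrier M. f (x \<oplus>\<^bsub>M\<^esub> y) = f x \<oplus>\<^bsub>N\<^esub> f y) \<and>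
       (\<forall>a\<in>carrier R. \<forall>x\<in>carrier M. f (a \<odot>\<^bsub>M\<^esub> x) = a \<odot>\<^bsub>N\<^esub> f x)}"

text \<open>Endomorphisms are written on the right, so in the product of \<open>f\<close> and \<open>g\<close>
  the map \<open>f\<close> is applied first.\<close>

definition right_End ::
    "('a, 'k) ring_scheme \<Rightarrow> ('a, 'b, 'l) module_scheme \<Rightarrow> ('a, 'b \<Rightarrow> 'b) module"
  where "right_End R M =
    \<lparr>carrier = linear_maps R M M,
     monoid.mult = (\<lambda>f g. compose (carrier M) g f),
     monoid.one = (\<lambda>x\<in>carrier M. x),
     ring.zero = (\<lambda>x\<in>carrier M. \<zero>\<^bsub>M\<^esub>),
     ring.add = (\<lambda>f g. \<lambda>x\<in>carrier M. f x \<oplus>\<^bsub>M\<^esub> g x),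
     module.smult = (\<lambda>a f. \<lambda>x\<in>carrier M. a \<odot>\<^bsub>M\<^esub> f x)\<rparr>"

locale right_representation = unital_algebra R A + M: module R M
  for R (structure) and A (structure) and M (structure) +
  fixes \<rho>
  assumes rep_hom: "\<rho> \<in> algebra_hom R A (right_End R M)"


section \<open>Free modules, free algebras and presentations\<close>

definition basis_vec :: "('a, 'k) ring_scheme \<Rightarrow> 'x \<Rightarrow> 'x \<Rightarrow> 'a"
  where "basis_vec R x = (\<lambda>y. if y = x then \<one>\<^bsub>R\<^esub> else \<zero>\<^bsub>R\<^esub>)"

text \<open>The fields \<open>mult\<close> and \<open>one\<close> play no role for a module.\<close>

definition free_module :: "('a, 'k) ring_scheme \<Rightarrow> 'x set \<Rightarrow> ('a, 'x \<Rightarrow> 'a) module"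
  where "free_module R S =
    \<lparr>carrier = {f. (\<forall>x. f x \<in> carrier R) \<and> (\<forall>x. x \<notin> S \<longrightarrow> f x = \<zero>\<^bsub>R\<^esub>) \<and>
                   finite {x. f x \<noteq> \<zero>\<^bsub>R\<^esub>}},
     monoid.mult = undefined,
     monoid.one = undefined,
     ring.zero = (\<lambda>x. \<zero>\<^bsub>R\<^esub>),
     ring.add = (\<lambda>f g x. f x \<oplus>\<^bsub>R\<^esub> g x),
     module.smult = (\<lambda>a f x. a \<otimes>\<^bsub>R\<^esub> f x)\<rparr>"

definition linear_extension ::
    "('a, 'k) ring_scheme \<Rightarrow> 'x set \<Rightarrow> ('a, 'b, 'l) module_scheme \<Rightarrow> ('x \<Rightarrow> 'b) \<Rightarrow> ('x \<Rightarrow> 'a) \<Rightarrow> 'b"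
  where "linear_extension R S M \<phi> =
    (\<lambda>f\<in>carrier (free_module R S). \<Oplus>\<^bsub>M\<^esub>x\<in>{x \<in> S. f x \<noteq> \<zero>\<^bsub>R\<^esub>}. f x \<odot>\<^bsub>M\<^esub> \<phi> x)"

definition concat_mult ::
    "('a, 'k) ring_scheme \<Rightarrow> ('x list \<Rightarrow> 'a) \<Rightarrow> ('x list \<Rightarrow> 'a) \<Rightarrow> 'x list \<Rightarrow> 'a"
  where "concat_mult R f g =
    (\<lambda>w. \<Oplus>\<^bsub>R\<^esub>k\<in>{..length w}. f (take k w) \<otimes>\<^bsub>R\<^esub> g (drop k w))"

definition free_algebra :: "('a, 'k) ring_scheme \<Rightarrow> 'x set \<Rightarrow> ('a, 'x list \<Rightarrow> 'a) module"
  where "free_algebra R S =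
    (free_module R (lists S))\<lparr>monoid.mult := concat_mult R, monoid.one := basis_vec R []\<rparr>"

definition quotient_algebra ::
    "('a, 'b, 'l) module_scheme \<Rightarrow> 'b set \<Rightarrow> ('a, 'b set) module"
  where "quotient_algebra A I =
    \<lparr>carrier = carrier (A Quot I),
     monoid.mult = monoid.mult (A Quot I),
     monoid.one = monoid.one (A Quot I),
     ring.zero = ring.zero (A Quot I),
     ring.add = ring.add (A Quot I),
     module.smult = (\<lambda>a C. \<Union>x\<in>C. I +>\<^bsub>A\<^esub> (a \<odot>\<^bsub>A\<^esub> x))\<rparr>"

text \<open>A pair \<open>(u, v)\<close> in \<open>E\<close> stands for the defining relation \<open>u = v\<close>.  In the library,
  \<^const>\<open>genideal\<close> yields two-sided ideals.\<close>

definition relation_ideal ::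
    "('a, 'k) ring_scheme \<Rightarrow> 'x set \<Rightarrow> (('x list \<Rightarrow> 'a) \<times> ('x list \<Rightarrow> 'a)) set \<Rightarrow> ('x list \<Rightarrow> 'a) set"
  where "relation_ideal R S E =
    Idl\<^bsub>free_algebra R S\<^esub> {u \<ominus>\<^bsub>free_algebra R S\<^esub> v | u v. (u, v) \<in> E}"

definition presented_algebra ::
    "('a, 'k) ring_scheme \<Rightarrow> 'x set \<Rightarrow> (('x list \<Rightarrow> 'a) \<times> ('x list \<Rightarrow> 'a)) set \<Rightarrow>
     ('a, ('x list \<Rightarrow> 'a) set) module"
  where "presented_algebra R S E = quotient_algebra (free_algebra R S) (relation_ideal R S E)"

definition presented_gen ::
    "('a, 'k) ring_scheme \<Rightarrow> 'x set \<Rightarrow> (('x list \<Rightarrow> 'a) \<times> ('x list \<Rightarrow> 'a)) set \<Rightarrow> 'x \<Rightarrow>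
     ('x list \<Rightarrow> 'a) set"
  where "presented_gen R S E x = relation_ideal R S E +>\<^bsub>free_algebra R S\<^esub> basis_vec R [x]"


section \<open>Tensor powers of a free module\<close>

text \<open>The tensor algebra of the free \<open>R\<close>-module \<open>V\<close> on \<open>B\<close> is the free algebra on \<open>B\<close>, with the
  tensor product of tensors as multiplication.  The tensor power of degree \<open>m\<close> is its homogeneous
  part of degree \<open>m\<close>; the word \<open>[b\<^sub>1, \<dots>, b\<^sub>m]\<close> stands for the basis vector
  \<open>b\<^sub>1 \<otimes> \<dots> \<otimes> b\<^sub>m\<close>.  In particular, \<open>V\<close> itself has the one-letter words as its basis.\<close>

definition words :: "'x set \<Rightarrow> nat \<Rightarrow> 'x list set"
  where "words B m = {w \<in> lists B. length w = m}"

definition tensor_power :: "('a, 'k) ring_scheme \<Rightarrow> 'x set \<Rightarrow> nat \<Rightarrow> ('a, 'x list \<Rightarrow> 'a) module"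
  where "tensor_power R B m = free_module R (words B m)"

abbreviation tensor ::
    "('a, 'k) ring_scheme \<Rightarrow> ('x list \<Rightarrow> 'a) \<Rightarrow> ('x list \<Rightarrow> 'a) \<Rightarrow> 'x list \<Rightarrow> 'a"
  where "tensor R \<equiv> concat_mult R"

lemma tensor_basis_vec:
  assumes "ring R"
  shows "tensor R (basis_vec R u) (basis_vec R w) = basis_vec R (u @ w)"
proof
  fix x
  interpret ring R by fact
  have "(take k x = u \<and> drop k x = w) \<longleftrightarrow> (k = length u \<and> x = u @ w)" if "k \<le> length x" for k
    using that by (metis append_eq_conv_conj append_take_drop_id length_take min.absorb2)
  then have "tensor R (basis_vec R u) (basis_vec R w) x =
    (\<Oplus>\<^bsub>R\<^esub>k\<in>{..length x}. if length u = k then if x = u @ w then \<one>\<^bsub>R\<^esub> else \<zero>\<^bsub>R\<^esub> else \<zero>\<^bsub>R\<^esub>)"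
    unfolding concat_mult_def by (intro finsum_cong') (auto simp: basis_vec_def)
  also have "\<dots> = basis_vec R (u @ w) x"
    by (cases "length u \<le> length x") (auto simp: basis_vec_def finsum_singleton)
  finally show "tensor R (basis_vec R u) (basis_vec R w) x = basis_vec R (u @ w) x" .
qed

text \<open>For an endomorphism \<open>A\<close> of the tensor power of degree \<open>k\<close>, the map \<open>act_at R B m k A i\<close> is
  \<open>A\<close> on the factors \<open>i, \<dots>, i + k - 1\<close> (counted from \<open>1\<close>) of the tensor power of degree \<open>m\<close>
  and the identity on the other factors.\<close>

definition act_at ::
    "('a, 'k) ring_scheme \<Rightarrow> 'x set \<Rightarrow> nat \<Rightarrow> nat \<Rightarrow> (('x list \<Rightarrow> 'a) \<Rightarrow> ('x list \<Rightarrow> 'a)) \<Rightarrow> nat \<Rightarrow>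
     ('x list \<Rightarrow> 'a) \<Rightarrow> ('x list \<Rightarrow> 'a)"
  where "act_at R B m k A i =
    linear_extension R (words B m) (tensor_power R B m)
      (\<lambda>w. tensor R (basis_vec R (take (i - 1) w))
             (tensor R (A (basis_vec R (take k (drop (i - 1) w))))
                       (basis_vec R (drop (i - 1 + k) w))))"


section \<open>The ground ring\<close>

text \<open>The ground ring is the subring of the field of rational functions in \<open>q_var\<close> over the complex
  numbers that is generated by the listed elements.\<close>

type_synonym scalar = "complex poly fract"

definition q_var :: scalar
  where "q_var = to_fract [:0, 1:]"

definition xi :: "nat \<Rightarrow> scalar"
  where "xi r = to_fract [:exp (2 * of_real pi * \<i> / of_nat r):]"

definition Delta :: "nat \<Rightarrow> scalar"
  where "Delta r = (\<Prod>(i, j)\<in>{(i, j). i < j \<and> j < r}. xi r ^ i - xi r ^ j)"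

definition ground_ring :: "nat \<Rightarrow> scalar ring"
  where "ground_ring r = ring_of_type_algebra
    \<lparr>carrier := generate_ring ring_of_type_algebra
       {q_var, inverse q_var, xi r, inverse (of_nat r), inverse (Delta r)}\<rparr>"


section \<open>The Yokonuma-Hecke algebra\<close>

datatype yh_generator = gen_g nat | gen_t nat

definition yh_generators :: "nat \<Rightarrow> yh_generator set"
  where "yh_generators n = gen_g ` {1..<n} \<union> gen_t ` {1..n}"

abbreviation yh_free :: "nat \<Rightarrow> nat \<Rightarrow> (scalar, yh_generator list \<Rightarrow> scalar) module"
  where "yh_free r n \<equiv> free_algebra (ground_ring r) (yh_generators n)"

definition free_g :: "nat \<Rightarrow> nat \<Rightarrow> yh_generator list \<Rightarrow> scalar"
  where "free_g r i = basis_vec (ground_ring r) [gen_g i]"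

definition free_t :: "nat \<Rightarrow> nat \<Rightarrow> yh_generator list \<Rightarrow> scalar"
  where "free_t r i = basis_vec (ground_ring r) [gen_t i]"

text \<open>The inverse of \<open>t\<^sub>j\<close>, which does not exist in the free algebra, is written as \<open>t\<^sub>j\<close> to the
  power \<open>r - 1\<close>; the two agree modulo the relation that the \<open>r\<close>-th power of \<open>t\<^sub>j\<close> is \<open>1\<close>.\<close>

definition free_e :: "nat \<Rightarrow> nat \<Rightarrow> nat \<Rightarrow> yh_generator list \<Rightarrow> scalar"
  where "free_e r n i =
    inverse (of_nat r) \<odot>\<^bsub>yh_free r n\<^esub>
      (\<Oplus>\<^bsub>yh_free r n\<^esub>s\<in>{..<r}.
         free_t r i [^]\<^bsub>yh_free r n\<^esub> s \<otimes>\<^bsub>yh_free r n\<^esub>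
         (free_t r (i + 1) [^]\<^bsub>yh_free r n\<^esub> (r - 1)) [^]\<^bsub>yh_free r n\<^esub> s)"

definition yh_relations ::
    "nat \<Rightarrow> nat \<Rightarrow> ((yh_generator list \<Rightarrow> scalar) \<times> (yh_generator list \<Rightarrow> scalar)) set"
  where "yh_relations r n =
    (let F = yh_free r n; g = free_g r; t = free_t r; e = free_e r n in
      {(t i [^]\<^bsub>F\<^esub> r, \<one>\<^bsub>F\<^esub>) | i. i \<in> {1..n}} \<union>
      {(t i \<otimes>\<^bsub>F\<^esub> t j, t j \<otimes>\<^bsub>F\<^esub> t i) | i j. i \<in> {1..n} \<and> j \<in> {1..n}} \<union>
      {(t j \<otimes>\<^bsub>F\<^esub> g i, g i \<otimes>\<^bsub>F\<^esub> t (transpose i (i + 1) j)) | i j. i \<in> {1..<n} \<and> j \<in> {1..n}} \<union>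
      {(g i \<otimes>\<^bsub>F\<^esub> g j, g j \<otimes>\<^bsub>F\<^esub> g i) | i j.
         i \<in> {1..<n} \<and> j \<in> {1..<n} \<and> \<bar>int i - int j\<bar> > 1} \<union>
      {(g i \<otimes>\<^bsub>F\<^esub> g (i + 1) \<otimes>\<^bsub>F\<^esub> g i, g (i + 1) \<otimes>\<^bsub>F\<^esub> g i \<otimes>\<^bsub>F\<^esub> g (i + 1)) | i.
         i \<in> {1..<n} \<and> i + 1 \<in> {1..<n}} \<union>
      {(g i [^]\<^bsub>F\<^esub> (2::nat), \<one>\<^bsub>F\<^esub> \<oplus>\<^bsub>F\<^esub> (q_var - inverse q_var) \<odot>\<^bsub>F\<^esub> (e i \<otimes>\<^bsub>F\<^esub> g i)) | i. i \<in> {1..<n}})"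

definition yokonuma_hecke :: "nat \<Rightarrow> nat \<Rightarrow> (scalar, (yh_generator list \<Rightarrow> scalar) set) module"
  where "yokonuma_hecke r n =
    presented_algebra (ground_ring r) (yh_generators n) (yh_relations r n)"

definition yh_g :: "nat \<Rightarrow> nat \<Rightarrow> nat \<Rightarrow> (yh_generator list \<Rightarrow> scalar) set"
  where "yh_g r n i =
    presented_gen (ground_ring r) (yh_generators n) (yh_relations r n) (gen_g i)"

definition yh_t :: "nat \<Rightarrow> nat \<Rightarrow> nat \<Rightarrow> (yh_generator list \<Rightarrow> scalar) set"
  where "yh_t r n i =
    presented_gen (ground_ring r) (yh_generators n) (yh_relations r n) (gen_t i)"


section \<open>The tensor space and its operators\<close>

text \<open>The pair \<open>(i, t)\<close> indexes the basis vector of \<open>V\<close> with lower index \<open>i\<close> and upper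
  index \<open>t\<close>.\<close>

definition V_index :: "nat \<Rightarrow> nat \<Rightarrow> (nat \<times> nat) set"
  where "V_index r n = {1..n} \<times> {..<r}"

definition V_tensor :: "nat \<Rightarrow> nat \<Rightarrow> nat \<Rightarrow> (scalar, (nat \<times> nat) list \<Rightarrow> scalar) module"
  where "V_tensor r n m = tensor_power (ground_ring r) (V_index r n) m"

definition v_basis :: "nat \<Rightarrow> nat \<Rightarrow> nat \<Rightarrow> (nat \<times> nat) list \<Rightarrow> scalar"
  where "v_basis r i t = basis_vec (ground_ring r) [(i, t)]"

definition op_T :: "nat \<Rightarrow> nat \<Rightarrow> ((nat \<times> nat) list \<Rightarrow> scalar) \<Rightarrow> (nat \<times> nat) list \<Rightarrow> scalar"
  where "op_T r n =
    linear_extension (ground_ring r) (words (V_index r n) 1) (V_tensor r n 1)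
      (\<lambda>w. case w of [(i, t)] \<Rightarrow> xi r ^ t \<odot>\<^bsub>V_tensor r n 1\<^esub> v_basis r i t)"

definition op_G :: "nat \<Rightarrow> nat \<Rightarrow> ((nat \<times> nat) list \<Rightarrow> scalar) \<Rightarrow> (nat \<times> nat) list \<Rightarrow> scalar"
  where "op_G r n =
    (let V2 = V_tensor r n 2; tens = tensor (ground_ring r) in
      linear_extension (ground_ring r) (words (V_index r n) 2) V2
        (\<lambda>w. case w of [(i, t), (j, s)] \<Rightarrow>
           if t \<noteq> s then tens (v_basis r j s) (v_basis r i t)
           else if i = j then q_var \<odot>\<^bsub>V2\<^esub> tens (v_basis r i t) (v_basis r j s)
           else if i > j then tens (v_basis r j s) (v_basis r i t)
           else (q_var - inverse q_var) \<odot>\<^bsub>V2\<^esub> tens (v_basis r i t) (v_basis r j s) \<oplus>\<^bsub>V2\<^esub>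
             tens (v_basis r j s) (v_basis r i t)))"

definition op_T_at :: "nat \<Rightarrow> nat \<Rightarrow> nat \<Rightarrow> ((nat \<times> nat) list \<Rightarrow> scalar) \<Rightarrow> (nat \<times> nat) list \<Rightarrow> scalar"
  where "op_T_at r n i = act_at (ground_ring r) (V_index r n) n 1 (op_T r n) i"

definition op_G_at :: "nat \<Rightarrow> nat \<Rightarrow> nat \<Rightarrow> ((nat \<times> nat) list \<Rightarrow> scalar) \<Rightarrow> (nat \<times> nat) list \<Rightarrow> scalar"
  where "op_G_at r n i = act_at (ground_ring r) (V_index r n) n 2 (op_G r n) i"

end

theory Submission
  imports Defs
begin

text \<open>The presented algebra has the expected universal property, so it suffices that the operators
  satisfy the defining relations, and these can be checked on the words that form a basis of the
  tensor space.  On such a word \<open>w\<close> the operator \<open>T\<^sub>i\<close> is a scalar, \<open>G\<^sub>i\<close> is a linear combination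
  of \<open>w\<close> and the word with the letters \<open>i\<close> and \<open>i + 1\<close> exchanged, and \<open>e\<^sub>i\<close> acts by \<open>1\<close> or \<open>0\<close>
  according to whether the upper indices of these letters agree, because the powers of \<open>\<xi>\<close> sum
  to zero.  The relations become identities between the coefficients.\<close>

section \<open>Free modules\<close>

text \<open>For equal upper indices \<open>op_G\<close> is an R-matrix of Hecke type on the lower
  indices, with eigenvalues \<open>q\<close> and \<open>-q^{-1}\<close>; for different upper indices
  it is the plain flip. The quadratic relation therefore has to specialise to
  \<open>g^2 = 1 + (q - q^{-1}) g\<close> in one regime and to \<open>g^2 = 1\<close> in the other,
  and \<open>e_i\<close>, the projection onto equal upper indices, is the switch between them. The
  braid relation is the hard one, because a word of three letters can mix the two regimes.
  Describing \<open>op_G\<close> by two scalars for each pair of letters treats both at once: the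
  relation becomes a few scalar identities, settled by comparing three letters. For equal upper
  indices they rest on transitivity of the order of the lower indices. All relations are tested in
  the free algebra, before any quotient is taken. There the evaluation map takes a product apart
  factor by factor, and no computation with cosets occurs.\<close>

lemma free_module_simps [simp]:
  "\<zero>\<^bsub>free_module R S\<^esub> = (\<lambda>x. \<zero>\<^bsub>R\<^esub>)"
  "f \<oplus>\<^bsub>free_module R S\<^esub> g = (\<lambda>x. f x \<oplus>\<^bsub>R\<^esub> g x)"
  "a \<odot>\<^bsub>free_module R S\<^esub> f = (\<lambda>x. a \<otimes>\<^bsub>R\<^esub> f x)"
  by (simp_all add: free_module_def)

lemma mem_free_module_iff:
  "f \<in> carrier (free_module R S) \<longleftrightarrow>
    (\<forall>x. f x \<in> carrier R) \<and> (\<forall>x. x \<notin> S \<longrightarrow> f x = \<zero>\<^bsub>R\<^esub>) \<and> finite {x. f x \<noteq> \<zero>\<^bsub>R\<^esub>}"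
  by (simp add: free_module_def)

context cring
begin

lemma basis_vec_closed [simp, intro]: "basis_vec R x y \<in> carrier R"
  by (simp add: basis_vec_def)

lemma basis_vec_in_free_module [simp, intro]:
  assumes "x \<in> S"
  shows "basis_vec R x \<in> carrier (free_module R S)"
proof -
  have "{y. basis_vec R x y \<noteq> \<zero>} \<subseteq> {x}"
    by (auto simp: basis_vec_def)
  then show ?thesis
    using assms finite_subset by (fastforce simp: mem_free_module_iff basis_vec_def)
qed

lemma free_module_smult_closed:
  assumes "a \<in> carrier R" "f \<in> carrier (free_module R S)"
  shows "(\<lambda>x. a \<otimes> f x) \<in> carrier (free_module R S)"
proof -
  have "{x. a \<otimes> f x \<noteq> \<zero>} \<subseteq> {x. f x \<noteq> \<zero>}"
    using assms by auto
  then show ?thesis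
    using assms finite_subset by (auto simp: mem_free_module_iff)
qed

lemma free_module_add_closed:
  assumes "f \<in> carrier (free_module R S)" "g \<in> carrier (free_module R S)"
  shows "(\<lambda>x. f x \<oplus> g x) \<in> carrier (free_module R S)"
proof -
  have "{x. f x \<oplus> g x \<noteq> \<zero>} \<subseteq> {x. f x \<noteq> \<zero>} \<union> {x. g x \<noteq> \<zero>}"
    using assms by auto
  moreover have "finite ({x. f x \<noteq> \<zero>} \<union> {x. g x \<noteq> \<zero>})"
    using assms by (simp add: mem_free_module_iff)
  ultimately have "finite {x. f x \<oplus> g x \<noteq> \<zero>}"
    using finite_subset by blast
  then show ?thesis
    using assms by (simp add: mem_free_module_iff)
qed

lemma module_free_module: "module R (free_module R S)"
proof (rule moduleI)
  show "abelian_group (free_module R S)"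
  proof (rule abelian_groupI)
    fix f assume f: "f \<in> carrier (free_module R S)"
    \<comment> \<open>The additive inverse is taken as a scalar multiple, so that closure under
      scalars already supplies its finite support.\<close>
    have "(\<lambda>x. \<ominus> \<one> \<otimes> f x) \<in> carrier (free_module R S)"
      using f by (intro free_module_smult_closed) auto
    moreover have "(\<lambda>x. \<ominus> \<one> \<otimes> f x \<oplus> f x) = (\<lambda>x. \<zero>)"
      using f by (auto simp: mem_free_module_iff l_minus l_neg)
    ultimately show "\<exists>g\<in>carrier (free_module R S). g \<oplus>\<^bsub>free_module R S\<^esub> f = \<zero>\<^bsub>free_module R S\<^esub>"
      by auto
  qed (auto intro: free_module_add_closed, auto simp: mem_free_module_iff fun_eq_iff a_ac)
next
  fix a f assume "a \<in> carrier R" "f \<in> carrier (free_module R S)"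
  then show "a \<odot>\<^bsub>free_module R S\<^esub> f \<in> carrier (free_module R S)"
    by (simp add: free_module_smult_closed)
qed (simp_all add: mem_free_module_iff l_distr r_distr m_assoc cring_axioms)

text \<open>Induction on the size of the support, clearing one coordinate at a time. The step has
  the shape scalar times basis vector plus remainder, so linearity alone carries a property from
  basis vectors to all vectors.\<close>

lemma free_module_induct [consumes 1, case_names zero add]:
  assumes "f \<in> carrier (free_module R S)"
    and zero: "P (\<lambda>x. \<zero>)"
    and add: "\<And>a x f. \<lbrakk>a \<in> carrier R; x \<in> S; f \<in> carrier (free_module R S); P f\<rbrakk> \<Longrightarrow>
      P (\<lambda>y. a \<otimes> basis_vec R x y \<oplus> f y)"
  shows "P f"
  using assms(1)
proof (induction "card {x. f x \<noteq> \<zero>}" arbitrary: f)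
  case 0
  then have "f = (\<lambda>x. \<zero>)"
    by (auto simp: mem_free_module_iff)
  then show ?case
    using zero by simp
next
  case (Suc k)
  then obtain x where x: "f x \<noteq> \<zero>"
    by (metis (mono_tags, lifting) card_gt_0_iff empty_Collect_eq zero_less_Suc)
  define g where "g = f(x := \<zero>)"
  have supp: "{y. g y \<noteq> \<zero>} = {y. f y \<noteq> \<zero>} - {x}"
    by (auto simp: g_def)
  have g: "g \<in> carrier (free_module R S)"
    using Suc.prems by (simp add: mem_free_module_iff supp) (simp add: g_def)
  have "card {y. g y \<noteq> \<zero>} = k"
    using Suc x by (simp add: supp mem_free_module_iff)
  then have "P g"
    using Suc.hyps(1) g by blast
  then have "P (\<lambda>y. f x \<otimes> basis_vec R x y \<oplus> g y)"
    using Suc.prems x by (intro add g) (auto simp: mem_free_module_iff)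
  moreover have "(\<lambda>y. f x \<otimes> basis_vec R x y \<oplus> g y) = f"
    using Suc.prems by (auto simp: g_def basis_vec_def mem_free_module_iff)
  ultimately show ?case
    by simp
qed

end

context module
begin

text \<open>Sums over the supports of different vectors are not directly comparable, since
  coefficients can cancel. Indices outside the support contribute zero, so a common finite index set
  may be used instead; for additivity it is the union of two supports.\<close>

lemma linear_extension_eq_finsum:
  assumes "f \<in> carrier (free_module R S)" "\<phi> \<in> S \<rightarrow> carrier M"
    and "finite A" "A \<subseteq> S" "{x. f x \<noteq> \<zero>} \<subseteq> A"
  shows "linear_extension R S M \<phi> f = (\<Oplus>\<^bsub>M\<^esub>x\<in>A. f x \<odot>\<^bsub>M\<^esub> \<phi> x)"
proof -
  have "(\<Oplus>\<^bsub>M\<^esub>x\<in>{x \<in> S. f x \<noteq> \<zero>}. f x \<odot>\<^bsub>M\<^esub> \<phi> x) = (\<Oplus>\<^bsub>M\<^esub>x\<in>A. f x \<odot>\<^bsub>M\<^esub> \<phi> x)"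
    using assms by (intro M.add.finprod_mono_neutral_cong_left)
      (auto simp: mem_free_module_iff intro!: smult_l_null smult_closed)
  then show ?thesis
    using assms by (simp add: linear_extension_def)
qed

lemma linear_extension_linear:
  assumes \<phi>: "\<phi> \<in> S \<rightarrow> carrier M"
  shows "linear_extension R S M \<phi> \<in> linear_maps R (free_module R S) M"
proof -
  let ?L = "linear_extension R S M \<phi>"
  have closed: "?L f \<in> carrier M" if "f \<in> carrier (free_module R S)" for f
    using that \<phi> by (auto simp: linear_extension_def mem_free_module_iff intro!: M.finsum_closed)
  have add: "?L (\<lambda>x. f x \<oplus> g x) = ?L f \<oplus>\<^bsub>M\<^esub> ?L g"
    if f: "f \<in> carrier (free_module R S)" and g: "g \<in> carrier (free_module R S)" for f g
  proof -
    define A where "A = {x. f x \<noteq> \<zero>} \<union> {x. g x \<noteq> \<zero>}"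
    have A: "finite A" "A \<subseteq> S" "{x. f x \<noteq> \<zero>} \<subseteq> A" "{x. g x \<noteq> \<zero>} \<subseteq> A"
      using f g by (auto simp: A_def mem_free_module_iff)
    have A': "{x. f x \<oplus> g x \<noteq> \<zero>} \<subseteq> A"
      using f g by (auto simp: A_def)
    have cl: "f x \<in> carrier R" "g x \<in> carrier R" for x
      using f g by (auto simp: mem_free_module_iff)
    have \<phi>_closed: "\<phi> x \<in> carrier M" if "x \<in> A" for x
      using that A \<phi> by auto
    have "?L (\<lambda>x. f x \<oplus> g x) = (\<Oplus>\<^bsub>M\<^esub>x\<in>A. (f x \<oplus> g x) \<odot>\<^bsub>M\<^esub> \<phi> x)"
      using A A' \<phi> f g by (intro linear_extension_eq_finsum R.free_module_add_closed) auto
    also have "\<dots> = (\<Oplus>\<^bsub>M\<^esub>x\<in>A. f x \<odot>\<^bsub>M\<^esub> \<phi> x \<oplus>\<^bsub>M\<^esub> g x \<odot>\<^bsub>M\<^esub> \<phi> x)"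
      using \<phi>_closed cl by (intro M.finsum_cong') (auto simp: smult_l_distr)
    also have "\<dots> = (\<Oplus>\<^bsub>M\<^esub>x\<in>A. f x \<odot>\<^bsub>M\<^esub> \<phi> x) \<oplus>\<^bsub>M\<^esub> (\<Oplus>\<^bsub>M\<^esub>x\<in>A. g x \<odot>\<^bsub>M\<^esub> \<phi> x)"
      using \<phi>_closed cl by (intro M.finsum_addf) auto
    finally show ?thesis
      using A \<phi> f g
      by (simp add: linear_extension_eq_finsum[of f S \<phi> A] linear_extension_eq_finsum[of g S \<phi> A])
  qed
  have smult: "?L (\<lambda>x. a \<otimes> f x) = a \<odot>\<^bsub>M\<^esub> ?L f"
    if a: "a \<in> carrier R" and f: "f \<in> carrier (free_module R S)" for a f
  proof -
    let ?A = "{x. f x \<noteq> \<zero>}"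
    have A: "finite ?A" "?A \<subseteq> S"
      using f by (auto simp: mem_free_module_iff)
    have cl: "f x \<in> carrier R" for x
      using f by (auto simp: mem_free_module_iff)
    have "?L (\<lambda>x. a \<otimes> f x) = (\<Oplus>\<^bsub>M\<^esub>x\<in>?A. (a \<otimes> f x) \<odot>\<^bsub>M\<^esub> \<phi> x)"
      using A \<phi> a f by (intro linear_extension_eq_finsum R.free_module_smult_closed) auto
    also have "\<dots> = (\<Oplus>\<^bsub>M\<^esub>x\<in>?A. a \<odot>\<^bsub>M\<^esub> (f x \<odot>\<^bsub>M\<^esub> \<phi> x))"
      using A \<phi> cl a by (intro M.finsum_cong') (auto intro!: smult_assoc1 smult_closed)
    also have "\<dots> = a \<odot>\<^bsub>M\<^esub> (\<Oplus>\<^bsub>M\<^esub>x\<in>?A. f x \<odot>\<^bsub>M\<^esub> \<phi> x)"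
      using A \<phi> cl a by (intro finsum_smult_ldistr[symmetric]) auto
    finally show ?thesis
      using A \<phi> f by (simp add: linear_extension_eq_finsum[of f S \<phi> ?A])
  qed
  show ?thesis
    using closed add smult by (auto simp: linear_maps_def linear_extension_def)
qed

lemma linear_extension_basis:
  assumes "\<phi> \<in> S \<rightarrow> carrier M" "x \<in> S"
  shows "linear_extension R S M \<phi> (basis_vec R x) = \<phi> x"
proof -
  have \<phi>x: "\<phi> x \<in> carrier M"
    using assms by blast
  have "linear_extension R S M \<phi> (basis_vec R x) = (\<Oplus>\<^bsub>M\<^esub>y\<in>{x}. basis_vec R x y \<odot>\<^bsub>M\<^esub> \<phi> y)"
  proof (rule linear_extension_eq_finsum)
    show "{y. basis_vec R x y \<noteq> \<zero>} \<subseteq> {x}"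
      by (auto simp: basis_vec_def)
  qed (use assms in auto)
  also have "\<dots> = basis_vec R x x \<odot>\<^bsub>M\<^esub> \<phi> x"
    using \<phi>x M.finsum_insert[of "{}" x "\<lambda>y. basis_vec R x y \<odot>\<^bsub>M\<^esub> \<phi> y"] by simp
  also have "\<dots> = \<phi> x"
    using \<phi>x by (simp add: basis_vec_def)
  finally show ?thesis .
qed

end

lemma linear_mapsD:
  assumes "f \<in> linear_maps R M N"
  shows linear_maps_closed: "x \<in> carrier M \<Longrightarrow> f x \<in> carrier N"
    and linear_maps_add:
      "x \<in> carrier M \<Longrightarrow> y \<in> carrier M \<Longrightarrow> f (x \<oplus>\<^bsub>M\<^esub> y) = f x \<oplus>\<^bsub>N\<^esub> f y"
    and linear_maps_smult:
      "a \<in> carrier R \<Longrightarrow> x \<in> carrier M \<Longrightarrow> f (a \<odot>\<^bsub>M\<^esub> x) = a \<odot>\<^bsub>N\<^esub> f x"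
  using assms by (auto simp: linear_maps_def)

lemma linear_maps_zero:
  assumes "module R M" "module R N" "f \<in> linear_maps R M N"
  shows "f \<zero>\<^bsub>M\<^esub> = \<zero>\<^bsub>N\<^esub>"
proof -
  interpret M: module R M by fact
  interpret N: module R N by fact
  have "f (\<zero>\<^bsub>R\<^esub> \<odot>\<^bsub>M\<^esub> \<zero>\<^bsub>M\<^esub>) = \<zero>\<^bsub>R\<^esub> \<odot>\<^bsub>N\<^esub> f \<zero>\<^bsub>M\<^esub>"
    using assms(3) by (intro linear_maps_smult) auto
  then show ?thesis
    using linear_maps_closed[OF assms(3)] by simp
qed

lemma (in module) linear_maps_free_eqI:
  assumes f: "f \<in> linear_maps R (free_module R S) M"
    and g: "g \<in> linear_maps R (free_module R S) M"
    and eq: "\<And>x. x \<in> S \<Longrightarrow> f (basis_vec R x) = g (basis_vec R x)"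
  shows "f = g"
proof (rule ext)
  fix v
  interpret F: module R "free_module R S"
    by (rule R.module_free_module)
  have "f v = g v" if "v \<in> carrier (free_module R S)"
    using that
  proof (induction rule: R.free_module_induct)
    case zero
    show ?case
      using linear_maps_zero[OF F.module_axioms module_axioms f]
        linear_maps_zero[OF F.module_axioms module_axioms g] by simp
  next
    case (add a x v)
    have "h (\<lambda>y. a \<otimes> basis_vec R x y \<oplus> v y) = a \<odot>\<^bsub>M\<^esub> h (basis_vec R x) \<oplus>\<^bsub>M\<^esub> h v"
      if h: "h \<in> linear_maps R (free_module R S) M" for h
      using linear_maps_add[OF h, of "\<lambda>y. a \<otimes> basis_vec R x y" v]
        linear_maps_smult[OF h, of a "basis_vec R x"] add
        F.smult_closed[of a "basis_vec R x"] by auto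
    then show ?case
      using f g add.IH eq[OF add.hyps(2)] by metis
  qed
  \<comment> \<open>Off the carrier both maps are \<open>undefined\<close>, because
    \<open>linear_maps\<close> contains only extensional functions.\<close>
  then show "f v = g v"
    using f g by (cases "v \<in> carrier (free_module R S)") (auto simp: linear_maps_def PiE_def extensional_def)
qed

section \<open>Free algebras\<close>

context cring
begin

lemma concat_mult_Nil:
  assumes "\<And>w. f w \<in> carrier R" "\<And>w. g w \<in> carrier R"
  shows "concat_mult R f g [] = f [] \<otimes> g []"
  using assms by (simp add: concat_mult_def Pi_iff)

text \<open>The cut at position 0 is split off; every later cut leaves \<open>x\<close> in the left
  part and is a cut of \<open>w\<close> for the shifted function. With this recursion associativity
  and the right unit law are inductions on the word, and no double sum has to be reindexed.\<close>

lemma concat_mult_Cons: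
  assumes "\<And>w. f w \<in> carrier R" "\<And>w. g w \<in> carrier R"
  shows "concat_mult R f g (x # w) = f [] \<otimes> g (x # w) \<oplus> concat_mult R (\<lambda>u. f (x # u)) g w"
  using assms by (simp add: concat_mult_def Pi_iff finsum_Suc2 a_comm del: finsum_Suc)

lemma concat_mult_closed [simp, intro]:
  assumes "\<And>w. f w \<in> carrier R" "\<And>w. g w \<in> carrier R"
  shows "concat_mult R f g w \<in> carrier R"
  using assms by (simp add: concat_mult_def Pi_iff)

lemma concat_mult_add_left:
  assumes "\<And>w. f w \<in> carrier R" "\<And>w. g w \<in> carrier R" "\<And>w. h w \<in> carrier R"
  shows "concat_mult R (\<lambda>w. f w \<oplus> g w) h = (\<lambda>w. concat_mult R f h w \<oplus> concat_mult R g h w)"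
proof
  fix w
  show "concat_mult R (\<lambda>w. f w \<oplus> g w) h w = concat_mult R f h w \<oplus> concat_mult R g h w"
    using assms by (simp add: concat_mult_def l_distr Pi_iff finsum_addf)
qed

lemma concat_mult_add_right:
  assumes "\<And>w. f w \<in> carrier R" "\<And>w. g w \<in> carrier R" "\<And>w. h w \<in> carrier R"
  shows "concat_mult R f (\<lambda>w. g w \<oplus> h w) = (\<lambda>w. concat_mult R f g w \<oplus> concat_mult R f h w)"
proof
  fix w
  show "concat_mult R f (\<lambda>w. g w \<oplus> h w) w = concat_mult R f g w \<oplus> concat_mult R f h w"
    using assms by (simp add: concat_mult_def r_distr Pi_iff finsum_addf)
qed

lemma concat_mult_smult_left:
  assumes "a \<in> carrier R" "\<And>w. f w \<in> carrier R" "\<And>w. g w \<in> carrier R"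
  shows "concat_mult R (\<lambda>w. a \<otimes> f w) g = (\<lambda>w. a \<otimes> concat_mult R f g w)"
proof
  fix w
  show "concat_mult R (\<lambda>w. a \<otimes> f w) g w = a \<otimes> concat_mult R f g w"
    using assms by (simp add: concat_mult_def m_assoc Pi_iff finsum_rdistr)
qed

lemma concat_mult_smult_right:
  assumes "a \<in> carrier R" "\<And>w. f w \<in> carrier R" "\<And>w. g w \<in> carrier R"
  shows "concat_mult R f (\<lambda>w. a \<otimes> g w) = (\<lambda>w. a \<otimes> concat_mult R f g w)"
proof
  fix w
  show "concat_mult R f (\<lambda>w. a \<otimes> g w) w = a \<otimes> concat_mult R f g w"
    using assms by (simp add: concat_mult_def m_lcomm Pi_iff finsum_rdistr)
qed

lemma concat_mult_zero_left:
  assumes "\<And>w. g w \<in> carrier R"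
  shows "concat_mult R (\<lambda>w. \<zero>) g = (\<lambda>w. \<zero>)"
  using assms by (simp add: concat_mult_def fun_eq_iff)

lemma concat_mult_zero_right:
  assumes "\<And>w. f w \<in> carrier R"
  shows "concat_mult R f (\<lambda>w. \<zero>) = (\<lambda>w. \<zero>)"
  using assms by (simp add: concat_mult_def fun_eq_iff)

lemma concat_mult_assoc:
  assumes "\<And>w. f w \<in> carrier R" "\<And>w. g w \<in> carrier R" "\<And>w. h w \<in> carrier R"
  shows "concat_mult R (concat_mult R f g) h = concat_mult R f (concat_mult R g h)"
proof
  fix w
  show "concat_mult R (concat_mult R f g) h w = concat_mult R f (concat_mult R g h) w"
    using assms(1)
  \<comment> \<open>The recursion replaces \<open>f\<close> by its shift \<open>?fx\<close>, so the
    claim must range over all \<open>f\<close>, while \<open>g\<close> and \<open>h\<close> stay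
    fixed.\<close>
  proof (induction w arbitrary: f)
    case Nil
    then show ?case
      using assms by (simp add: concat_mult_Nil m_assoc)
  next
    case (Cons x w)
    let ?fx = "\<lambda>u. f (x # u)" and ?gx = "\<lambda>u. g (x # u)"
    have "concat_mult R (concat_mult R f g) h (x # w) =
        (f [] \<otimes> g []) \<otimes> h (x # w) \<oplus> concat_mult R (\<lambda>u. f [] \<otimes> ?gx u \<oplus> concat_mult R ?fx g u) h w"
      using assms Cons.prems by (simp add: concat_mult_Nil concat_mult_Cons)
    also have "\<dots> = f [] \<otimes> (g [] \<otimes> h (x # w) \<oplus> concat_mult R ?gx h w) \<oplus>
        concat_mult R (concat_mult R ?fx g) h w"
      using assms Cons.prems
      by (simp add: concat_mult_add_left concat_mult_smult_left m_assoc a_assoc r_distr)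
    also have "concat_mult R (concat_mult R ?fx g) h w = concat_mult R ?fx (concat_mult R g h) w"
      using Cons by simp
    finally show ?case
      using assms Cons.prems by (simp add: concat_mult_Cons)
  qed
qed

lemma concat_mult_one_left:
  assumes "\<And>w. g w \<in> carrier R"
  shows "concat_mult R (basis_vec R []) g = g"
proof
  fix w
  have "(\<lambda>u. basis_vec R [] (x # u)) = (\<lambda>u. \<zero>)" for x :: 'c
    by (simp add: basis_vec_def)
  then show "concat_mult R (basis_vec R []) g w = g w"
    using assms
    by (cases w) (simp_all add: concat_mult_Nil concat_mult_Cons concat_mult_zero_left,
      simp_all add: basis_vec_def)
qed

lemma concat_mult_one_right:
  assumes "\<And>w. f w \<in> carrier R"
  shows "concat_mult R f (basis_vec R []) = f"
proof
  fix w
  show "concat_mult R f (basis_vec R []) w = f w"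
    using assms
  proof (induction w arbitrary: f)
    case (Cons x w)
    then show ?case
      by (simp add: concat_mult_Cons) (simp add: basis_vec_def)
  qed (simp add: concat_mult_Nil, simp add: basis_vec_def)
qed

text \<open>A word in the support of the product is a concatenation of words from the two supports,
  which bounds the support by a finite set. The three index sets are kept apart to serve both the
  free algebra and the tensor powers, where degrees add.\<close>

lemma concat_mult_in_free_module:
  assumes f: "f \<in> carrier (free_module R S)" and g: "g \<in> carrier (free_module R T)"
    and app: "\<And>u v. u \<in> S \<Longrightarrow> v \<in> T \<Longrightarrow> u @ v \<in> U"
  shows "concat_mult R f g \<in> carrier (free_module R U)"
proof -
  have cl: "f w \<in> carrier R" "g w \<in> carrier R" for w
    using f g by (auto simp: mem_free_module_iff)
  have supp: "\<exists>u v. f u \<noteq> \<zero> \<and> g v \<noteq> \<zero> \<and> w = u @ v" if "concat_mult R f g w \<noteq> \<zero>" for w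
  proof (rule ccontr)
    assume *: "\<not> ?thesis"
    have "f (take k w) \<otimes> g (drop k w) = \<zero>" for k
      using * cl by (metis append_take_drop_id l_null r_null)
    then have "concat_mult R f g w = \<zero>"
      by (simp add: concat_mult_def)
    with that show False
      by simp
  qed
  have "{w. concat_mult R f g w \<noteq> \<zero>} \<subseteq> (\<lambda>(u, v). u @ v) ` ({u. f u \<noteq> \<zero>} \<times> {v. g v \<noteq> \<zero>})"
    using supp by fastforce
  moreover have "finite ((\<lambda>(u, v). u @ v) ` ({u. f u \<noteq> \<zero>} \<times> {v. g v \<noteq> \<zero>}))"
    using f g by (simp add: mem_free_module_iff)
  ultimately have "finite {w. concat_mult R f g w \<noteq> \<zero>}"
    by (rule finite_subset)
  moreover have "concat_mult R f g w = \<zero>" if "w \<notin> U" for w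
    using supp[of w] app that f g unfolding mem_free_module_iff by metis
  ultimately show ?thesis
    using cl by (simp add: mem_free_module_iff)
qed

lemma free_algebra_simps [simp]:
  "carrier (free_algebra R S) = carrier (free_module R (lists S))"
  "\<zero>\<^bsub>free_algebra R S\<^esub> = (\<lambda>w. \<zero>)"
  "f \<oplus>\<^bsub>free_algebra R S\<^esub> g = (\<lambda>w. f w \<oplus> g w)"
  "a \<odot>\<^bsub>free_algebra R S\<^esub> f = (\<lambda>w. a \<otimes> f w)"
  "f \<otimes>\<^bsub>free_algebra R S\<^esub> g = concat_mult R f g"
  "\<one>\<^bsub>free_algebra R S\<^esub> = basis_vec R []"
  by (simp_all add: free_algebra_def free_module_def)

end

text \<open>A free algebra is a free module with these two fields overwritten, and the module axioms
  speak only of addition and scalars.\<close>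

lemma (in module) module_update_mult_one: "module R (M\<lparr>monoid.mult := m, monoid.one := e\<rparr>)"
proof (rule moduleI)
  show "abelian_group (M\<lparr>monoid.mult := m, monoid.one := e\<rparr>)"
    by (rule abelian_groupI) (auto simp: M.a_ac intro: M.add.l_inv_ex)
qed (auto simp: R.cring_axioms smult_l_distr smult_r_distr smult_assoc1)

lemma (in cring) unital_algebra_free_algebra: "unital_algebra R (free_algebra R S)"
proof -
  interpret F: module R "free_algebra R S"
    unfolding free_algebra_def by (intro module.module_update_mult_one module_free_module)
  have cl: "\<And>w. f w \<in> carrier R" if "f \<in> carrier (free_module R (lists S))" for f
    using that by (simp add: mem_free_module_iff)
  have mult_closed: "concat_mult R f g \<in> carrier (free_module R (lists S))"
    if "f \<in> carrier (free_module R (lists S))" "g \<in> carrier (free_module R (lists S))" for f g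
    using that by (rule concat_mult_in_free_module) auto
  have "ring (free_algebra R S)"
  proof (rule ringI)
    show "Group.monoid (free_algebra R S)"
      by (rule Group.monoidI)
        (auto simp: cl concat_mult_assoc concat_mult_one_left concat_mult_one_right
          mult_closed)
  qed (simp_all add: F.abelian_group_axioms cl concat_mult_add_left concat_mult_add_right)
  then show ?thesis
    by (intro unital_algebra.intro F.module_axioms unital_algebra_axioms.intro)
      (simp_all add: cl concat_mult_smult_left concat_mult_smult_right)
qed

section \<open>Evaluation homomorphisms of the free algebra\<close>

definition free_algebra_lift ::
    "('a, 'k) ring_scheme \<Rightarrow> 'x set \<Rightarrow> ('a, 'b, 'l) module_scheme \<Rightarrow> ('x \<Rightarrow> 'b) \<Rightarrow> ('x list \<Rightarrow> 'a) \<Rightarrow> 'b"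
  where "free_algebra_lift R S B \<phi> =
    linear_extension R (lists S) B (\<lambda>w. foldr (\<lambda>x b. \<phi> x \<otimes>\<^bsub>B\<^esub> b) w \<one>\<^bsub>B\<^esub>)"

context unital_algebra
begin

context
  fixes S and \<phi>
  assumes \<phi>: "\<phi> \<in> S \<rightarrow> carrier A"
begin

lemma word_value_closed: "w \<in> lists S \<Longrightarrow> foldr (\<lambda>x b. \<phi> x \<otimes>\<^bsub>A\<^esub> b) w \<one>\<^bsub>A\<^esub> \<in> carrier A"
  using \<phi> by (induction w) auto

lemma word_value_append:
  assumes "u \<in> lists S" "v \<in> lists S"
  shows "foldr (\<lambda>x b. \<phi> x \<otimes>\<^bsub>A\<^esub> b) (u @ v) \<one>\<^bsub>A\<^esub> =
    foldr (\<lambda>x b. \<phi> x \<otimes>\<^bsub>A\<^esub> b) u \<one>\<^bsub>A\<^esub> \<otimes>\<^bsub>A\<^esub> foldr (\<lambda>x b. \<phi> x \<otimes>\<^bsub>A\<^esub> b) v \<one>\<^bsub>A\<^esub>"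
  using assms(1)
proof (induction u)
  case Nil
  then show ?case
    using word_value_closed[OF assms(2)] by simp
next
  case (Cons x u)
  then show ?case
    using \<phi> word_value_closed[of u] word_value_closed[OF assms(2)] by (simp add: m_assoc Pi_iff)
qed

lemma free_algebra_lift_linear:
  "free_algebra_lift R S A \<phi> \<in> linear_maps R (free_module R (lists S)) A"
  unfolding free_algebra_lift_def using word_value_closed by (intro linear_extension_linear) auto

lemma free_algebra_lift_word:
  "w \<in> lists S \<Longrightarrow> free_algebra_lift R S A \<phi> (basis_vec R w) = foldr (\<lambda>x b. \<phi> x \<otimes>\<^bsub>A\<^esub> b) w \<one>\<^bsub>A\<^esub>"
  unfolding free_algebra_lift_def using word_value_closed by (intro linear_extension_basis) auto

lemma free_algebra_lift_gen:
  assumes "x \<in> S"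
  shows "free_algebra_lift R S A \<phi> (basis_vec R [x]) = \<phi> x"
proof -
  have "\<phi> x \<in> carrier A"
    using assms \<phi> by auto
  then show ?thesis
    using assms by (simp add: free_algebra_lift_word)
qed

text \<open>Matches the step of \<open>free_module_induct\<close>.\<close>

lemma free_algebra_lift_combination:
  assumes "a \<in> carrier R" "f \<in> carrier (free_module R (lists S))" "g \<in> carrier (free_module R (lists S))"
  shows "free_algebra_lift R S A \<phi> (\<lambda>w. a \<otimes> f w \<oplus> g w) =
    a \<odot>\<^bsub>A\<^esub> free_algebra_lift R S A \<phi> f \<oplus>\<^bsub>A\<^esub> free_algebra_lift R S A \<phi> g"
  using linear_maps_add[OF free_algebra_lift_linear, of "\<lambda>w. a \<otimes> f w" g]
    linear_maps_smult[OF free_algebra_lift_linear, of a f] assms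
  by (simp add: free_module_smult_closed)

text \<open>Both sides are bilinear and agree on two words by \<open>word_value_append\<close>. The
  first induction (\<open>word\<close>) frees the right factor with a word on the left, the second
  then frees the left factor.\<close>

lemma free_algebra_lift_mult:
  assumes f: "f \<in> carrier (free_module R (lists S))" and g: "g \<in> carrier (free_module R (lists S))"
  shows "free_algebra_lift R S A \<phi> (concat_mult R f g) =
    free_algebra_lift R S A \<phi> f \<otimes>\<^bsub>A\<^esub> free_algebra_lift R S A \<phi> g"
proof -
  let ?F = "free_module R (lists S)" and ?L = "free_algebra_lift R S A \<phi>"
  have cl: "\<And>w. f w \<in> carrier R" if "f \<in> carrier ?F" for f
    using that by (simp add: mem_free_module_iff)
  have L_closed: "?L f \<in> carrier A" if "f \<in> carrier ?F" for f
    using linear_maps_closed[OF free_algebra_lift_linear that] .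
  have mult_closed: "concat_mult R f g \<in> carrier ?F" if "f \<in> carrier ?F" "g \<in> carrier ?F" for f g
    using that by (rule concat_mult_in_free_module) auto
  have L_zero: "?L (\<lambda>w. \<zero>) = \<zero>\<^bsub>A\<^esub>"
    using linear_maps_zero[OF module_free_module module_axioms free_algebra_lift_linear] by simp
  have word: "?L (concat_mult R (basis_vec R u) g) = ?L (basis_vec R u) \<otimes>\<^bsub>A\<^esub> ?L g"
    if u: "u \<in> lists S" for u
    using g
  proof (induction rule: free_module_induct)
    case zero
    show ?case
      using u by (simp add: concat_mult_zero_right L_zero L_closed)
  next
    case (add a v g)
    have "?L (concat_mult R (basis_vec R u) (\<lambda>w. a \<otimes> basis_vec R v w \<oplus> g w)) =
        ?L (\<lambda>w. a \<otimes> basis_vec R (u @ v) w \<oplus> concat_mult R (basis_vec R u) g w)"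
      using add cl
      by (simp add: concat_mult_add_right concat_mult_smult_right tensor_basis_vec R.ring_axioms)
    also have "\<dots> = a \<odot>\<^bsub>A\<^esub> (?L (basis_vec R u) \<otimes>\<^bsub>A\<^esub> ?L (basis_vec R v)) \<oplus>\<^bsub>A\<^esub>
        ?L (basis_vec R u) \<otimes>\<^bsub>A\<^esub> ?L g"
      using u add
      by (simp add: free_algebra_lift_combination free_algebra_lift_word word_value_append mult_closed
          del: foldr_append)
    also have "\<dots> = ?L (basis_vec R u) \<otimes>\<^bsub>A\<^esub> ?L (\<lambda>w. a \<otimes> basis_vec R v w \<oplus> g w)"
      using u add
      by (simp add: free_algebra_lift_combination L_closed r_distr smult_mult_right)
    finally show ?case .
  qed
  show ?thesis
    using f
  proof (induction rule: free_module_induct)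
    case zero
    show ?case
      using g cl by (simp add: concat_mult_zero_left L_zero L_closed)
  next
    case (add a u f)
    have "?L (concat_mult R (\<lambda>w. a \<otimes> basis_vec R u w \<oplus> f w) g) =
        ?L (\<lambda>w. a \<otimes> concat_mult R (basis_vec R u) g w \<oplus> concat_mult R f g w)"
      using add cl g by (simp add: concat_mult_add_left concat_mult_smult_left)
    also have "\<dots> = a \<odot>\<^bsub>A\<^esub> (?L (basis_vec R u) \<otimes>\<^bsub>A\<^esub> ?L g) \<oplus>\<^bsub>A\<^esub> ?L f \<otimes>\<^bsub>A\<^esub> ?L g"
      using add g by (simp add: free_algebra_lift_combination word mult_closed)
    also have "\<dots> = ?L (\<lambda>w. a \<otimes> basis_vec R u w \<oplus> f w) \<otimes>\<^bsub>A\<^esub> ?L g"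
      using add g by (simp add: free_algebra_lift_combination L_closed l_distr smult_mult_left)
    finally show ?case .
  qed
qed

lemma free_algebra_lift_hom: "free_algebra_lift R S A \<phi> \<in> algebra_hom R (free_algebra R S) A"
proof -
  note lin = free_algebra_lift_linear
  have "free_algebra_lift R S A \<phi> \<in> ring_hom (free_algebra R S) A"
    using linear_maps_closed[OF lin] linear_maps_add[OF lin]
    by (intro ring_hom_memI) (simp_all add: free_algebra_lift_mult free_algebra_lift_word)
  then show ?thesis
    using linear_maps_smult[OF lin] by (simp add: algebra_hom_def)
qed

end

end

section \<open>Quotients, endomorphism algebras and presentations\<close>

lemma quotient_algebra_simps [simp]:
  "carrier (quotient_algebra A I) = carrier (A Quot I)"
  "monoid.mult (quotient_algebra A I) = monoid.mult (A Quot I)"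
  "\<one>\<^bsub>quotient_algebra A I\<^esub> = \<one>\<^bsub>A Quot I\<^esub>"
  "\<zero>\<^bsub>quotient_algebra A I\<^esub> = \<zero>\<^bsub>A Quot I\<^esub>"
  "ring.add (quotient_algebra A I) = ring.add (A Quot I)"
  by (simp_all add: quotient_algebra_def)

context unital_algebra
begin

text \<open>Scaling by \<open>a\<close> is multiplication by the ring element
  \<open>a \<odot> \<one>\<close>, so a ring ideal is automatically a submodule.\<close>

lemma ideal_smult_closed:
  assumes "ideal I A" "a \<in> carrier R" "x \<in> I"
  shows "a \<odot>\<^bsub>A\<^esub> x \<in> I"
proof -
  interpret I: ideal I A by fact
  have x: "x \<in> carrier A"
    using assms(3) by (rule I.a_Hcarr)
  have "(a \<odot>\<^bsub>A\<^esub> \<one>\<^bsub>A\<^esub>) \<otimes>\<^bsub>A\<^esub> x = a \<odot>\<^bsub>A\<^esub> x"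
    using assms x by (simp add: smult_mult_left)
  then show ?thesis
    using I.I_l_closed[OF assms(3), of "a \<odot>\<^bsub>A\<^esub> \<one>\<^bsub>A\<^esub>"] assms by simp
qed

text \<open>By definition the scalar multiple of a coset is a union over all its representatives.
  Two representatives differ by an element of \<open>I\<close>, which stays in \<open>I\<close>
  after scaling, so all the cosets in the union coincide.\<close>

lemma quotient_algebra_smult:
  assumes "ideal I A" "a \<in> carrier R" "x \<in> carrier A"
  shows "a \<odot>\<^bsub>quotient_algebra A I\<^esub> (I +>\<^bsub>A\<^esub> x) = I +>\<^bsub>A\<^esub> (a \<odot>\<^bsub>A\<^esub> x)"
proof -
  interpret I: ideal I A by fact
  have "I +>\<^bsub>A\<^esub> (a \<odot>\<^bsub>A\<^esub> y) = I +>\<^bsub>A\<^esub> (a \<odot>\<^bsub>A\<^esub> x)" if "y \<in> I +>\<^bsub>A\<^esub> x" for y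
  proof -
    obtain i where i: "i \<in> I" "y = i \<oplus>\<^bsub>A\<^esub> x"
      using \<open>y \<in> I +>\<^bsub>A\<^esub> x\<close> by (auto simp: a_r_coset_def r_coset_def)
    have "a \<odot>\<^bsub>A\<^esub> y = a \<odot>\<^bsub>A\<^esub> i \<oplus>\<^bsub>A\<^esub> a \<odot>\<^bsub>A\<^esub> x"
      using i assms I.a_Hcarr by (simp add: smult_r_distr)
    then have "a \<odot>\<^bsub>A\<^esub> y \<in> I +>\<^bsub>A\<^esub> (a \<odot>\<^bsub>A\<^esub> x)"
      using ideal_smult_closed[OF assms(1,2) i(1)] by (auto simp: a_r_coset_def r_coset_def)
    then show ?thesis
      using I.a_repr_independence' assms by (metis smult_closed)
  qed
  moreover have "x \<in> I +>\<^bsub>A\<^esub> x"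
    using assms by (simp add: I.a_rcos_self)
  ultimately show ?thesis
    unfolding quotient_algebra_def module.simps by (intro SUP_eq_const) blast+
qed

lemma unital_algebra_quotient_algebra:
  assumes "ideal I A"
  shows "unital_algebra R (quotient_algebra A I)"
proof -
  interpret I: ideal I A by fact
  have rep: "\<exists>x\<in>carrier A. C = I +>\<^bsub>A\<^esub> x" if "C \<in> carrier (A Quot I)" for C
    using that by (auto simp: FactRing_simps)
  have coset: "I +>\<^bsub>A\<^esub> x \<in> carrier (A Quot I)" if "x \<in> carrier A" for x
    using that by (auto simp: FactRing_simps)
  have add: "(I +>\<^bsub>A\<^esub> x) \<oplus>\<^bsub>A Quot I\<^esub> (I +>\<^bsub>A\<^esub> y) = I +>\<^bsub>A\<^esub> (x \<oplus>\<^bsub>A\<^esub> y)"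
    if "x \<in> carrier A" "y \<in> carrier A" for x y
    using that by (simp add: FactRing_def I.a_rcos_sum)
  have mult: "(I +>\<^bsub>A\<^esub> x) \<otimes>\<^bsub>A Quot I\<^esub> (I +>\<^bsub>A\<^esub> y) = I +>\<^bsub>A\<^esub> (x \<otimes>\<^bsub>A\<^esub> y)"
    if "x \<in> carrier A" "y \<in> carrier A" for x y
    using that by (simp add: FactRing_def I.rcoset_mult_add)
  note smult = quotient_algebra_smult[OF assms]
  interpret Q: ring "A Quot I"
    by (rule I.quotient_is_ring)
  have ab: "abelian_group (quotient_algebra A I)"
    by (rule abelian_groupI) (auto simp: Q.a_ac intro: Q.add.l_inv_ex)
  have ring: "ring (quotient_algebra A I)"
    by (intro ringI ab Group.monoidI) (auto simp: Q.m_assoc Q.l_distr Q.r_distr)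
  \<comment> \<open>With the carrier written as an image, each axiom about cosets becomes one about
    representatives, where the corresponding axiom of \<open>A\<close> applies.\<close>
  have carrier_eq: "carrier (A Quot I) = (\<lambda>x. I +>\<^bsub>A\<^esub> x) ` carrier A"
    using rep coset by blast
  have "module R (quotient_algebra A I)"
    by (rule moduleI[OF R.cring_axioms ab], unfold quotient_algebra_simps carrier_eq)
      (elim imageE, simp add: smult add smult_l_distr smult_r_distr smult_assoc1)+
  moreover have "unital_algebra_axioms R (quotient_algebra A I)"
    by (rule unital_algebra_axioms.intro, unfold quotient_algebra_simps carrier_eq)
      (elim imageE, simp add: smult mult smult_mult_left smult_mult_right)+
  ultimately show ?thesis
    by (intro unital_algebra.intro ring)
qed

lemma quotient_algebra_lift:
  assumes I: "ideal I A" and B: "unital_algebra R B" and h: "h \<in> algebra_hom R A B"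
    and ker: "\<And>x. x \<in> I \<Longrightarrow> h x = \<zero>\<^bsub>B\<^esub>"
  shows "\<exists>\<rho>\<in>algebra_hom R (quotient_algebra A I) B. \<forall>x\<in>carrier A. \<rho> (I +>\<^bsub>A\<^esub> x) = h x"
proof -
  interpret I: ideal I A by fact
  interpret B: unital_algebra R B by fact
  have h_ring: "h \<in> ring_hom A B" and h_smult: "\<And>a x. a \<in> carrier R \<Longrightarrow> x \<in> carrier A \<Longrightarrow>
      h (a \<odot>\<^bsub>A\<^esub> x) = a \<odot>\<^bsub>B\<^esub> h x"
    using h by (auto simp: algebra_hom_def)
  note h_closed = ring_hom_closed[OF h_ring]
  \<comment> \<open>\<open>h\<close> is constant on every coset of \<open>I\<close>, so its image
    there is a singleton and no representative has to be chosen.\<close>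
  let ?\<rho> = "\<lambda>C. the_elem (h ` C)"
  have coset: "?\<rho> (I +>\<^bsub>A\<^esub> x) = h x" if "x \<in> carrier A" for x
  proof -
    have "h (i \<oplus>\<^bsub>A\<^esub> x) = h x" if "i \<in> I" for i
      using that \<open>x \<in> carrier A\<close> I.a_Hcarr h_closed
      by (simp add: ring_hom_add[OF h_ring] ker)
    moreover have "h ` (I +>\<^bsub>A\<^esub> x) = (\<lambda>i. h (i \<oplus>\<^bsub>A\<^esub> x)) ` I"
      by (auto simp: a_r_coset_def r_coset_def)
    moreover have "\<zero>\<^bsub>A\<^esub> \<in> I"
      by (rule I.zero_closed)
    ultimately have "h ` (I +>\<^bsub>A\<^esub> x) = {h x}"
      by (simp add: image_constant[of "\<zero>\<^bsub>A\<^esub>"])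
    then show ?thesis
      by simp
  qed
  have rep: "\<exists>x\<in>carrier A. C = I +>\<^bsub>A\<^esub> x" if "C \<in> carrier (A Quot I)" for C
    using that by (auto simp: FactRing_simps)
  note smult = quotient_algebra_smult[OF I]
  have "?\<rho> \<in> ring_hom (quotient_algebra A I) B"
  proof (rule ring_hom_memI)
    show "?\<rho> \<one>\<^bsub>quotient_algebra A I\<^esub> = \<one>\<^bsub>B\<^esub>"
      using ring_hom_one[OF h_ring] by (simp add: FactRing_def coset)
  next
    fix C D
    assume "C \<in> carrier (quotient_algebra A I)" "D \<in> carrier (quotient_algebra A I)"
    then obtain x y where "x \<in> carrier A" "C = I +>\<^bsub>A\<^esub> x" "y \<in> carrier A" "D = I +>\<^bsub>A\<^esub> y"
      unfolding quotient_algebra_simps using rep by meson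
    then show "?\<rho> (C \<otimes>\<^bsub>quotient_algebra A I\<^esub> D) = ?\<rho> C \<otimes>\<^bsub>B\<^esub> ?\<rho> D"
      and "?\<rho> (C \<oplus>\<^bsub>quotient_algebra A I\<^esub> D) = ?\<rho> C \<oplus>\<^bsub>B\<^esub> ?\<rho> D"
      using ring_hom_mult[OF h_ring] ring_hom_add[OF h_ring]
      by (simp_all add: FactRing_def I.rcoset_mult_add I.a_rcos_sum coset)
  next
    fix C assume "C \<in> carrier (quotient_algebra A I)"
    then obtain x where "x \<in> carrier A" "C = I +>\<^bsub>A\<^esub> x"
      unfolding quotient_algebra_simps using rep by meson
    then show "?\<rho> C \<in> carrier B"
      by (simp add: coset h_closed)
  qed
  moreover have "?\<rho> (a \<odot>\<^bsub>quotient_algebra A I\<^esub> C) = a \<odot>\<^bsub>B\<^esub> ?\<rho> C"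
    if a: "a \<in> carrier R" and C: "C \<in> carrier (A Quot I)" for a C
  proof -
    obtain x where "x \<in> carrier A" "C = I +>\<^bsub>A\<^esub> x"
      using rep C by blast
    then show ?thesis
      using a by (simp add: smult coset h_smult)
  qed
  ultimately have "?\<rho> \<in> algebra_hom R (quotient_algebra A I) B"
    by (simp add: algebra_hom_def)
  then show ?thesis
    using coset by (intro bexI[of _ ?\<rho>]) auto
qed

end

section \<open>The algebra of endomorphisms written on the right\<close>

lemma right_End_simps [simp]:
  "carrier (right_End R M) = linear_maps R M M"
  "f \<otimes>\<^bsub>right_End R M\<^esub> g = compose (carrier M) g f"
  "\<one>\<^bsub>right_End R M\<^esub> = (\<lambda>x\<in>carrier M. x)"
  "\<zero>\<^bsub>right_End R M\<^esub> = (\<lambda>x\<in>carrier M. \<zero>\<^bsub>M\<^esub>)"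
  "f \<oplus>\<^bsub>right_End R M\<^esub> g = (\<lambda>x\<in>carrier M. f x \<oplus>\<^bsub>M\<^esub> g x)"
  "a \<odot>\<^bsub>right_End R M\<^esub> f = (\<lambda>x\<in>carrier M. a \<odot>\<^bsub>M\<^esub> f x)"
  by (simp_all add: right_End_def)

context module
begin

lemma right_End_closed:
  shows right_End_mult_closed: "\<lbrakk>f \<in> linear_maps R M M; g \<in> linear_maps R M M\<rbrakk> \<Longrightarrow>
      compose (carrier M) g f \<in> linear_maps R M M"
    and right_End_one_closed: "(\<lambda>x\<in>carrier M. x) \<in> linear_maps R M M"
    and right_End_zero_closed: "(\<lambda>x\<in>carrier M. \<zero>\<^bsub>M\<^esub>) \<in> linear_maps R M M"
    and right_End_add_closed: "\<lbrakk>f \<in> linear_maps R M M; g \<in> linear_maps R M M\<rbrakk> \<Longrightarrow>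
      (\<lambda>x\<in>carrier M. f x \<oplus>\<^bsub>M\<^esub> g x) \<in> linear_maps R M M"
    and right_End_smult_closed: "\<lbrakk>a \<in> carrier R; f \<in> linear_maps R M M\<rbrakk> \<Longrightarrow>
      (\<lambda>x\<in>carrier M. a \<odot>\<^bsub>M\<^esub> f x) \<in> linear_maps R M M"
proof -
  \<comment> \<open>Commutativity of \<open>R\<close> enters here: it makes a scalar multiple of a
    linear map linear.\<close>
  have swap: "a \<odot>\<^bsub>M\<^esub> (b \<odot>\<^bsub>M\<^esub> x) = b \<odot>\<^bsub>M\<^esub> (a \<odot>\<^bsub>M\<^esub> x)"
    if "a \<in> carrier R" "b \<in> carrier R" "x \<in> carrier M" for a b x
    using that by (metis smult_assoc1 R.m_comm)
  show "\<lbrakk>f \<in> linear_maps R M M; g \<in> linear_maps R M M\<rbrakk> \<Longrightarrow>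
      compose (carrier M) g f \<in> linear_maps R M M"
    "(\<lambda>x\<in>carrier M. x) \<in> linear_maps R M M"
    "(\<lambda>x\<in>carrier M. \<zero>\<^bsub>M\<^esub>) \<in> linear_maps R M M"
    by (auto simp: linear_maps_def compose_def Pi_iff PiE_iff)
  show "(\<lambda>x\<in>carrier M. f x \<oplus>\<^bsub>M\<^esub> g x) \<in> linear_maps R M M"
    if "f \<in> linear_maps R M M" "g \<in> linear_maps R M M"
    using that by (auto simp: linear_maps_def PiE_iff smult_r_distr M.a_ac)
  show "(\<lambda>x\<in>carrier M. a \<odot>\<^bsub>M\<^esub> f x) \<in> linear_maps R M M"
    if "a \<in> carrier R" "f \<in> linear_maps R M M"
    using that by (auto simp: linear_maps_def PiE_iff smult_r_distr swap)
qed

lemma unital_algebra_right_End: "unital_algebra R (right_End R M)"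
proof -
  note closed = right_End_closed right_End_closed(1)[unfolded compose_def]
  note app = linear_maps_closed[where R = R and M = M and N = M]
    linear_maps_add[where R = R and M = M and N = M] linear_maps_smult[where R = R and M = M and N = M]
  have ext: "(\<lambda>x\<in>carrier M. f x) = f" if "f \<in> linear_maps R M M" for f
    using that by (auto simp: linear_maps_def)
  have ab: "abelian_group (right_End R M)"
  proof (rule abelian_groupI)
    fix f assume f: "f \<in> carrier (right_End R M)"
    then have "(\<lambda>x\<in>carrier M. \<ominus> \<one> \<odot>\<^bsub>M\<^esub> f x) \<in> carrier (right_End R M)"
      by (simp add: closed)
    moreover have "(\<lambda>x\<in>carrier M. \<ominus> \<one> \<odot>\<^bsub>M\<^esub> f x) \<oplus>\<^bsub>right_End R M\<^esub> f = \<zero>\<^bsub>right_End R M\<^esub>"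
      using f by (auto simp: smult_l_minus M.l_neg app intro!: restrict_ext)
    ultimately show "\<exists>g\<in>carrier (right_End R M). g \<oplus>\<^bsub>right_End R M\<^esub> f = \<zero>\<^bsub>right_End R M\<^esub>"
      by blast
  qed (simp_all add: closed app M.a_ac ext cong: restrict_cong)
  have ring: "ring (right_End R M)"
  proof (rule ringI[OF ab])
    show "Group.monoid (right_End R M)"
      by (rule Group.monoidI) (simp_all add: closed app compose_def ext cong: restrict_cong)
  qed (simp_all add: closed app compose_def cong: restrict_cong)
  have "module R (right_End R M)"
    by (rule moduleI[OF R.cring_axioms ab])
      (simp_all add: closed app smult_l_distr smult_r_distr smult_assoc1 ext cong: restrict_cong)
  then show ?thesis
    by (intro unital_algebra.intro ring unital_algebra_axioms.intro)
      (simp_all add: closed app compose_def cong: restrict_cong)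
qed

end

section \<open>The universal property of a presentation\<close>

context cring
begin

context
  fixes S :: "'x set" and E
  assumes E: "E \<subseteq> carrier (free_algebra R S) \<times> carrier (free_algebra R S)"
begin

interpretation F: unital_algebra R "free_algebra R S"
  by (rule unital_algebra_free_algebra)

lemma ideal_relation_ideal: "ideal (relation_ideal R S E) (free_algebra R S)"
  unfolding relation_ideal_def
proof (rule F.genideal_ideal, safe)
  fix u v assume "(u, v) \<in> E"
  then show "u \<ominus>\<^bsub>free_algebra R S\<^esub> v \<in> carrier (free_algebra R S)"
    using E by (intro F.minus_closed) blast+
qed

lemma unital_algebra_presented_algebra: "unital_algebra R (presented_algebra R S E)"
  unfolding presented_algebra_def
  by (rule F.unital_algebra_quotient_algebra[OF ideal_relation_ideal])

text \<open>The kernel of the evaluation map is a two-sided ideal containing all differences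
  \<open>u - v\<close> from \<open>E\<close>, hence also the ideal they generate. The evaluation
  therefore factors through the quotient.\<close>

lemma presented_algebra_lift:
  assumes B: "unital_algebra R B" and \<phi>: "\<phi> \<in> S \<rightarrow> carrier B"
    and rel: "\<And>u v. (u, v) \<in> E \<Longrightarrow> free_algebra_lift R S B \<phi> u = free_algebra_lift R S B \<phi> v"
  shows "\<exists>\<rho>\<in>algebra_hom R (presented_algebra R S E) B. \<forall>x\<in>S. \<rho> (presented_gen R S E x) = \<phi> x"
proof -
  interpret B: unital_algebra R B by fact
  let ?h = "free_algebra_lift R S B \<phi>"
  have h: "?h \<in> algebra_hom R (free_algebra R S) B"
    by (rule B.free_algebra_lift_hom[OF \<phi>])
  then interpret h: ring_hom_ring "free_algebra R S" B ?h
    by (intro ring_hom_ringI2 F.ring_axioms B.ring_axioms) (simp add: algebra_hom_def)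
  have "relation_ideal R S E \<subseteq> a_kernel (free_algebra R S) B ?h"
    unfolding relation_ideal_def
  proof (rule F.genideal_minimal[OF h.kernel_is_ideal], safe)
    fix u v assume uv: "(u, v) \<in> E"
    have u: "u \<in> carrier (free_algebra R S)" and v: "v \<in> carrier (free_algebra R S)"
      using uv E by blast+
    have "?h (u \<ominus>\<^bsub>free_algebra R S\<^esub> v) = ?h u \<ominus>\<^bsub>B\<^esub> ?h v"
      unfolding a_minus_def using u v F.a_inv_closed h.hom_add h.hom_a_inv by metis
    also have "\<dots> = \<zero>\<^bsub>B\<^esub>"
      using rel[OF uv] B.r_right_minus_eq[OF h.hom_closed[OF u] h.hom_closed[OF v]] by (rule iffD2[rotated])
    finally show "u \<ominus>\<^bsub>free_algebra R S\<^esub> v \<in> a_kernel (free_algebra R S) B ?h"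
      unfolding a_kernel_def' mem_Collect_eq by (rule conjI[OF F.minus_closed[OF u v]])
  qed
  then have "?h x = \<zero>\<^bsub>B\<^esub>" if "x \<in> relation_ideal R S E" for x
    using that h.kernel_zero by blast
  from F.quotient_algebra_lift[OF ideal_relation_ideal B h this]
  obtain \<rho> where \<rho>: "\<rho> \<in> algebra_hom R (presented_algebra R S E) B"
    and \<rho>_coset: "\<forall>x\<in>carrier (free_algebra R S). \<rho> (relation_ideal R S E +>\<^bsub>free_algebra R S\<^esub> x) = ?h x"
    unfolding presented_algebra_def by blast
  have "\<rho> (presented_gen R S E x) = \<phi> x" if "x \<in> S" for x
    using that \<rho>_coset by (simp add: presented_gen_def B.free_algebra_lift_gen[OF \<phi>])
  with \<rho> show ?thesis
    by blast
qed

end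

end

text \<open>From here on, elements of the free algebra are handled through its ring operations and
  the homomorphism laws of the evaluation, so these operations must stay folded.\<close>

declare (in cring) free_algebra_simps [simp del]

section \<open>Operators on tensor powers\<close>

lemma words_append: "u \<in> words B k \<Longrightarrow> v \<in> words B m \<Longrightarrow> u @ v \<in> words B (k + m)"
  by (auto simp: words_def)

context cring
begin

lemma tensor_closed:
  assumes "f \<in> carrier (tensor_power R B k)" "g \<in> carrier (tensor_power R B m)"
  shows "tensor R f g \<in> carrier (tensor_power R B (k + m))"
  using assms unfolding tensor_power_def by (rule concat_mult_in_free_module) (rule words_append)

lemma basis_vec_in_tensor_power: "w \<in> words B m \<Longrightarrow> basis_vec R w \<in> carrier (tensor_power R B m)"
  by (simp add: tensor_power_def)

lemma module_tensor_power: "module R (tensor_power R B m)"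
  unfolding tensor_power_def by (rule module_free_module)

context
  fixes B :: "'x set" and m k i :: nat and A
  assumes A: "A \<in> linear_maps R (tensor_power R B k) (tensor_power R B k)"
    and i: "i \<ge> 1" "i - 1 + k \<le> m"
begin

lemma act_at_image_closed:
  "(\<lambda>w. tensor R (basis_vec R (take (i - 1) w))
      (tensor R (A (basis_vec R (take k (drop (i - 1) w)))) (basis_vec R (drop (i - 1 + k) w))))
    \<in> words B m \<rightarrow> carrier (tensor_power R B m)"
proof
  fix w assume w: "w \<in> words B m"
  then have parts: "take (i - 1) w \<in> words B (i - 1)" "take k (drop (i - 1) w) \<in> words B k"
    "drop (i - 1 + k) w \<in> words B (m - (i - 1 + k))"
    using i by (auto simp: words_def dest: in_set_takeD in_set_dropD)
  have "tensor R (basis_vec R (take (i - 1) w))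
      (tensor R (A (basis_vec R (take k (drop (i - 1) w)))) (basis_vec R (drop (i - 1 + k) w)))
    \<in> carrier (tensor_power R B (i - 1 + (k + (m - (i - 1 + k)))))"
    by (intro tensor_closed linear_maps_closed[OF A] basis_vec_in_tensor_power parts)
  then show "tensor R (basis_vec R (take (i - 1) w))
      (tensor R (A (basis_vec R (take k (drop (i - 1) w)))) (basis_vec R (drop (i - 1 + k) w)))
    \<in> carrier (tensor_power R B m)"
    \<comment> \<open>\<open>i - 1 + k \<le> m\<close> makes the truncated subtraction exact, so the
      three degrees add up to \<open>m\<close>.\<close>
    using i by simp
qed

lemma act_at_linear:
  "act_at R B m k A i \<in> linear_maps R (tensor_power R B m) (tensor_power R B m)"
  using module.linear_extension_linear[OF module_tensor_power act_at_image_closed]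
  by (simp add: act_at_def tensor_power_def)

text \<open>Two terms suffice for both operators: \<open>op_G\<close> produces a diagonal and an
  exchanged term, and \<open>op_T\<close> is covered by \<open>b = 0\<close>.\<close>

lemma act_at_basis:
  assumes w: "u @ x @ v \<in> words B m" and len: "length u = i - 1" "length x = k"
    and a: "a \<in> carrier R" and b: "b \<in> carrier R"
    and Ax: "A (basis_vec R x) = (\<lambda>p. a \<otimes> basis_vec R y p \<oplus> b \<otimes> basis_vec R z p)"
  shows "act_at R B m k A i (basis_vec R (u @ x @ v)) =
    (\<lambda>p. a \<otimes> basis_vec R (u @ y @ v) p \<oplus> b \<otimes> basis_vec R (u @ z @ v) p)"
proof -
  have "act_at R B m k A i (basis_vec R (u @ x @ v)) =
      tensor R (basis_vec R u) (tensor R (A (basis_vec R x)) (basis_vec R v))"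
    using module.linear_extension_basis[OF module_tensor_power act_at_image_closed w] len
    by (simp add: act_at_def)
  also have "\<dots> = (\<lambda>p. a \<otimes> basis_vec R (u @ y @ v) p \<oplus> b \<otimes> basis_vec R (u @ z @ v) p)"
    using a b by (simp add: Ax concat_mult_add_left concat_mult_add_right concat_mult_smult_left
        concat_mult_smult_right tensor_basis_vec ring_axioms)
  finally show ?thesis .
qed

end

end

section \<open>The ground ring\<close>

lemma ground_ring_simps [simp]:
  "x \<otimes>\<^bsub>ground_ring r\<^esub> y = x * y"
  "x \<oplus>\<^bsub>ground_ring r\<^esub> y = x + y"
  "\<one>\<^bsub>ground_ring r\<^esub> = 1"
  "\<zero>\<^bsub>ground_ring r\<^esub> = 0"
  by (simp_all add: ground_ring_def ring_of_type_algebra_def)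

lemma cring_ground_ring: "cring (ground_ring r)"
proof -
  interpret K: cring "ring_of_type_algebra :: scalar ring"
    by (rule cring_from_type_algebra)
  have "subcring (carrier (ground_ring r)) (ring_of_type_algebra :: scalar ring)"
    unfolding ground_ring_def
    by (auto intro!: K.subcringI' K.generate_ring_is_subring) (simp_all add: ring_of_type_algebra_def)
  with K.subcring_iff[OF subringE(1)[OF subcring.axioms(1)[OF this]]] show ?thesis
    by (simp add: ground_ring_def)
qed

lemma ground_ring_generators:
  "q_var \<in> carrier (ground_ring r)" "inverse q_var \<in> carrier (ground_ring r)"
  "xi r \<in> carrier (ground_ring r)" "inverse (of_nat r) \<in> carrier (ground_ring r)"
  by (auto simp: ground_ring_def intro: generate_ring.incl)

lemma ground_ring_closed [simp]:
  shows ground_ring_add_closed: "x \<in> carrier (ground_ring r) \<Longrightarrow> y \<in> carrier (ground_ring r) \<Longrightarrow>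
      x + y \<in> carrier (ground_ring r)"
    and ground_ring_mult_closed: "x \<in> carrier (ground_ring r) \<Longrightarrow> y \<in> carrier (ground_ring r) \<Longrightarrow>
      x * y \<in> carrier (ground_ring r)"
    and ground_ring_zero_closed: "0 \<in> carrier (ground_ring r)"
    and ground_ring_one_closed: "1 \<in> carrier (ground_ring r)"
    and ground_ring_diff_closed: "x \<in> carrier (ground_ring r) \<Longrightarrow> y \<in> carrier (ground_ring r) \<Longrightarrow>
      x - y \<in> carrier (ground_ring r)"
proof -
  interpret cring "ground_ring r"
    by (rule cring_ground_ring)
  show "x \<in> carrier (ground_ring r) \<Longrightarrow> y \<in> carrier (ground_ring r) \<Longrightarrow> x + y \<in> carrier (ground_ring r)"
    "x \<in> carrier (ground_ring r) \<Longrightarrow> y \<in> carrier (ground_ring r) \<Longrightarrow> x * y \<in> carrier (ground_ring r)"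
    "0 \<in> carrier (ground_ring r)" "1 \<in> carrier (ground_ring r)"
    using a_closed[of x y] m_closed[of x y] zero_closed one_closed by auto
  show "x - y \<in> carrier (ground_ring r)"
    if x: "x \<in> carrier (ground_ring r)" and y: "y \<in> carrier (ground_ring r)"
  proof -
    \<comment> \<open>The negative of the ring record is identified with that of the fraction field
      by uniqueness of additive inverses.\<close>
    have "y + (\<ominus>\<^bsub>ground_ring r\<^esub> y) = 0"
      using r_neg[OF y] by simp
    then have "\<ominus>\<^bsub>ground_ring r\<^esub> y = - y"
      by (simp add: eq_neg_iff_add_eq_0 add.commute)
    then show ?thesis
      using a_closed[OF x a_inv_closed[OF y]] by simp
  qed
qed

lemma ground_ring_power_closed [simp]:
  "x \<in> carrier (ground_ring r) \<Longrightarrow> x ^ k \<in> carrier (ground_ring r)"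
  by (induction k) auto

lemma q_var_nonzero: "q_var \<noteq> 0"
  by (simp add: q_var_def)

text \<open>The form with \<open>cis\<close> connects the powers of \<open>\<xi>\<close> to the
  enumeration of the complex roots of unity by \<open>bij_betw_roots_unity\<close>.\<close>

lemma xi_power: "xi r ^ k = to_fract [:cis (2 * pi * real k / real r):]"
proof (induction k)
  case (Suc k)
  have "exp (2 * of_real pi * \<i> / of_nat r) = cis (2 * pi / real r)"
    by (simp add: cis_conv_exp mult_ac)
  then have "xi r * to_fract [:cis (2 * pi * real k / real r):] =
      to_fract [:cis (2 * pi / real r) * cis (2 * pi * real k / real r):]"
    by (simp add: xi_def flip: to_fract_mult)
  also have "cis (2 * pi / real r) * cis (2 * pi * real k / real r) = cis (2 * pi * real (Suc k) / real r)"
    by (simp add: cis_mult add_divide_distrib distrib_left)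
  finally show ?case
    using Suc by simp
qed (simp flip: one_pCons)

lemma xi_power_self:
  assumes "r \<ge> 1"
  shows "xi r ^ r = 1"
  using assms by (simp add: xi_power flip: one_pCons)

text \<open>Primitivity of \<open>\<xi>\<close>: the eigenvalues of \<open>T\<close> separate the
  upper indices, which is what enables \<open>e_i\<close> to detect their equality.\<close>

lemma xi_power_inj:
  assumes "xi r ^ s = xi r ^ t" "s < r" "t < r"
  shows "s = t"
proof -
  have "cis (2 * pi * real s / real r) = cis (2 * pi * real t / real r)"
    using assms(1) by (simp add: xi_power)
  moreover have "inj_on (\<lambda>k. cis (2 * pi * real k / real r)) {..<r}"
    using bij_betw_roots_unity[of r] assms(2) by (simp add: bij_betw_def)
  ultimately show ?thesis
    using assms(2,3) by (auto dest: inj_onD)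
qed

text \<open>Characteristic zero, so that \<open>inverse (of_nat r)\<close> is a true inverse and not
  the default value \<open>inverse 0 = 0\<close>.\<close>

lemma of_nat_scalar_eq_0_iff: "(of_nat k :: scalar) = 0 \<longleftrightarrow> k = 0"
proof -
  have "(of_nat k :: scalar) = to_fract (of_nat k)"
    by (induction k) simp_all
  then show ?thesis
    by simp
qed

text \<open>Since the power \<open>r - 1\<close> inverts an \<open>r\<close>-th root of unity, the
  sum is geometric with ratio \<open>c = \<xi>^(s - t)\<close>. It equals \<open>r\<close> for
  \<open>c = 1\<close>; otherwise \<open>(c - 1)\<close> times the sum is
  \<open>c^r - 1 = 0\<close>, and \<open>c - 1\<close> can be cancelled in the field.\<close>

lemma idempotent_eigenvalue:
  assumes r: "r \<ge> 1" and s: "s < r" and t: "t < r"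
  shows "inverse (of_nat r) * (\<Sum>k<r. (xi r ^ s) ^ k * ((xi r ^ t) ^ (r - 1)) ^ k) = (if s = t then 1 else 0)"
proof -
  define c where "c = xi r ^ s * (xi r ^ t) ^ (r - 1)"
  have root: "(xi r ^ k) ^ r = 1" for k
    using xi_power_self[OF r] by (metis mult.commute power_mult power_one)
  have inv: "(xi r ^ t) ^ (r - 1) * xi r ^ t = 1"
    using root[of t] r by (metis mult.commute power_minus_mult zero_less_one less_le_trans)
  have sum: "(\<Sum>k<r. (xi r ^ s) ^ k * ((xi r ^ t) ^ (r - 1)) ^ k) = (\<Sum>k<r. c ^ k)"
    by (simp add: c_def power_mult_distrib)
  show ?thesis
  proof (cases "s = t")
    case True
    then have "c = 1"
      using inv by (simp add: c_def mult.commute)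
    then show ?thesis
      unfolding sum using r True of_nat_scalar_eq_0_iff[of r] by simp
  next
    case False
    have "c \<noteq> 1"
    proof
      assume "c = 1"
      have "xi r ^ s * ((xi r ^ t) ^ (r - 1) * xi r ^ t) = c * xi r ^ t"
        by (simp only: c_def mult.assoc)
      then have "xi r ^ s = xi r ^ t"
        unfolding inv \<open>c = 1\<close> by simp
      then show False
        using False xi_power_inj[OF _ s t] by simp
    qed
    moreover have "c ^ r = 1"
    proof -
      have "((xi r ^ t) ^ (r - 1)) ^ r = ((xi r ^ t) ^ r) ^ (r - 1)"
        by (simp only: mult_ac flip: power_mult)
      then show ?thesis
        by (simp add: c_def power_mult_distrib root)
    qed
    moreover have "(c - 1) * (\<Sum>k<r. c ^ k) = c ^ r - 1"
      by (simp add: power_diff_1_eq)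
    ultimately show ?thesis
      unfolding sum using False by simp
  qed
qed

section \<open>The operators on the tensor space\<close>

text \<open>In terms of index pairs, \<open>G\<close> maps \<open>a \<otimes> b\<close> to \<open>G_diag a b\<close> times \<open>a \<otimes> b\<close> plus \<open>G_swap a b\<close> times
  \<open>b \<otimes> a\<close>.  For \<open>a = b\<close> the two vectors coincide, and the whole coefficient is put into \<open>G_diag\<close>.\<close>

definition G_diag :: "nat \<times> nat \<Rightarrow> nat \<times> nat \<Rightarrow> scalar"
  where "G_diag a b =
    (if snd a \<noteq> snd b \<or> fst a > fst b then 0 else if a = b then q_var else q_var - inverse q_var)"

definition G_swap :: "nat \<times> nat \<Rightarrow> nat \<times> nat \<Rightarrow> scalar"
  where "G_swap a b = (if a = b then 0 else 1)"

lemma G_diag_closed [simp]: "G_diag a b \<in> carrier (ground_ring r)"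
  and G_swap_closed [simp]: "G_swap a b \<in> carrier (ground_ring r)"
  by (simp_all add: G_diag_def G_swap_def ground_ring_generators)

lemma G_diag_eq_0: "snd a \<noteq> snd b \<Longrightarrow> G_diag a b = 0"
  by (simp add: G_diag_def)

text \<open>Coefficient of \<open>a \<otimes> b\<close> in the quadratic relation; the
  \<open>if\<close> is the eigenvalue of \<open>e_i\<close>. For \<open>a = b\<close> it reads
  \<open>q^2 = 1 + (q - q^{-1}) q\<close>; for \<open>a \<noteq> b\<close> the product of the swaps
  gives the \<open>1\<close>, and \<open>G_diag a b\<close> is \<open>0\<close> or
  \<open>q - q^{-1}\<close>.\<close>

lemma G_quadratic_diag:
  "G_diag a b * G_diag a b + G_swap a b * G_swap b a =
    1 + (q_var - inverse q_var) * ((if snd a = snd b then 1 else 0) * G_diag a b)"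
  using q_var_nonzero by (cases a; cases b) (auto simp: G_diag_def G_swap_def field_simps)

text \<open>Coefficient of \<open>b \<otimes> a\<close>. For distinct letters with equal upper index
  exactly one of the two diagonal coefficients is \<open>q - q^{-1}\<close> and the other is
  \<open>0\<close>.\<close>

lemma G_quadratic_swap:
  "G_diag a b * G_swap a b + G_swap a b * G_diag b a =
    (q_var - inverse q_var) * ((if snd a = snd b then 1 else 0) * G_swap a b)"
  by (cases a; cases b) (auto simp: G_diag_def G_swap_def)

text \<open>Coefficients of \<open>a \<otimes> b \<otimes> c\<close>, \<open>b \<otimes> a \<otimes> c\<close> and \<open>a \<otimes> c \<otimes> b\<close> in the two
  sides of the braid relation; the other three coefficients are visibly equal.  No
  distinctness is needed: the coefficients agree even where some of the six words coincide.\<close>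

lemma G_braid_identity:
  "G_diag a b * G_diag b c * G_diag a b + G_swap a b * G_diag a c * G_swap b a =
    G_diag b c * G_diag a b * G_diag b c + G_swap b c * G_diag a c * G_swap c b"
  using q_var_nonzero
  by (cases a; cases b; cases c) (auto simp: G_diag_def G_swap_def field_simps)

lemma G_braid_left:
  "(G_diag a b * G_diag b c + G_diag a c * G_diag b a) * G_swap a b =
    G_diag b c * G_swap a b * G_diag a c"
  by (cases a; cases b; cases c) (auto simp: G_diag_def G_swap_def)

lemma G_braid_right:
  "(G_diag b c * G_diag a b + G_diag a c * G_diag c b) * G_swap b c =
    G_diag a b * G_swap b c * G_diag a c"
  by (cases a; cases b; cases c) (auto simp: G_diag_def G_swap_def)

text \<open>Tensor factors are counted from 1 and list entries from 0, so the factors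
  \<open>i\<close> and \<open>i + 1\<close> are the entries \<open>i - 1\<close> and
  \<open>i\<close>.\<close>

definition swap_at :: "nat \<Rightarrow> 'x list \<Rightarrow> 'x list"
  where "swap_at i w = w[i - 1 := w ! i, i := w ! (i - 1)]"

lemma length_swap_at [simp]: "length (swap_at i w) = length w"
  by (simp add: swap_at_def)

lemma nth_swap_at:
  assumes "1 \<le> i" "i < length w" "k < length w"
  shows "swap_at i w ! k = (if k = i - 1 then w ! i else if k = i then w ! (i - 1) else w ! k)"
  using assms by (auto simp: swap_at_def nth_list_update)

lemma swap_at_words: "w \<in> words B m \<Longrightarrow> i < m \<Longrightarrow> swap_at i w \<in> words B m"
  by (auto simp: words_def swap_at_def dest!: set_update_subset_insert[THEN subsetD])

text \<open>With the next two lemmas, the Coxeter relations for exchanging adjacent places. They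
  identify the words reached along the two sides of a relation.\<close>

lemma swap_at_swap_at: "1 \<le> i \<Longrightarrow> i < length w \<Longrightarrow> swap_at i (swap_at i w) = w"
  by (rule nth_equalityI) (auto simp: nth_swap_at)

lemma swap_at_commute:
  assumes "1 \<le> i" "i < length w" "1 \<le> j" "j < length w" "\<bar>int i - int j\<bar> > 1"
  shows "swap_at i (swap_at j w) = swap_at j (swap_at i w)"
  using assms by (intro nth_equalityI) (auto simp: nth_swap_at)

lemma swap_at_braid:
  assumes "1 \<le> i" "i + 1 < length w"
  shows "swap_at i (swap_at (i + 1) (swap_at i w)) = swap_at (i + 1) (swap_at i (swap_at (i + 1) w))"
  using assms by (intro nth_equalityI) (auto simp: nth_swap_at)

definition yh_action :: "nat \<Rightarrow> nat \<Rightarrow> yh_generator \<Rightarrow> ((nat \<times> nat) list \<Rightarrow> scalar) \<Rightarrow> (nat \<times> nat) list \<Rightarrow> scalar"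
  where "yh_action r n x = (case x of gen_g i \<Rightarrow> op_G_at r n i | gen_t i \<Rightarrow> op_T_at r n i)"

section \<open>The operators evaluated on basis words\<close>

context
  fixes r n :: nat
begin

interpretation R: cring "ground_ring r"
  by (rule cring_ground_ring)

interpretation V: module "ground_ring r" "V_tensor r n m" for m
  unfolding V_tensor_def by (rule R.module_tensor_power)

abbreviation (input) ebasis :: "(nat \<times> nat) list \<Rightarrow> (nat \<times> nat) list \<Rightarrow> scalar"
  where "ebasis \<equiv> basis_vec (ground_ring r)"

abbreviation (input) Vwords :: "nat \<Rightarrow> (nat \<times> nat) list set"
  where "Vwords \<equiv> words (V_index r n)"

lemma V_tensor_simps:
  "\<zero>\<^bsub>V_tensor r n m\<^esub> = (\<lambda>x. 0)"
  "f \<oplus>\<^bsub>V_tensor r n m\<^esub> g = (\<lambda>x. f x + g x)"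
  "a \<odot>\<^bsub>V_tensor r n m\<^esub> f = (\<lambda>x. a * f x)"
  by (simp_all add: V_tensor_def tensor_power_def)

lemma ebasis_closed: "w \<in> Vwords m \<Longrightarrow> ebasis w \<in> carrier (V_tensor r n m)"
  unfolding V_tensor_def by (rule R.basis_vec_in_tensor_power)

lemma V_combination_closed:
  assumes "a \<in> carrier (ground_ring r)" "b \<in> carrier (ground_ring r)"
    and "x \<in> carrier (V_tensor r n m)" "y \<in> carrier (V_tensor r n m)"
  shows "(\<lambda>p. a * x p + b * y p) \<in> carrier (V_tensor r n m)"
  using V.M.add.m_closed[OF V.smult_closed[OF assms(1,3)] V.smult_closed[OF assms(2,4)]]
  by (simp add: V_tensor_simps)

lemma linear_combination:
  assumes f: "f \<in> linear_maps (ground_ring r) (V_tensor r n m) (V_tensor r n m)"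
    and "a \<in> carrier (ground_ring r)" "b \<in> carrier (ground_ring r)"
    and "x \<in> carrier (V_tensor r n m)" "y \<in> carrier (V_tensor r n m)"
  shows "f (\<lambda>p. a * x p + b * y p) = (\<lambda>p. a * f x p + b * f y p)"
  using linear_maps_add[OF f V.smult_closed V.smult_closed, OF assms(2,4,3,5)]
    linear_maps_smult[OF f] assms
  by (simp add: V_tensor_simps)

lemma linear_smult:
  assumes f: "f \<in> linear_maps (ground_ring r) (V_tensor r n m) (V_tensor r n m)"
    and "a \<in> carrier (ground_ring r)" "x \<in> carrier (V_tensor r n m)"
  shows "f (\<lambda>p. a * x p) = (\<lambda>p. a * f x p)"
  using linear_maps_smult[OF f] assms by (simp add: V_tensor_simps)

lemma words_1: "Vwords 1 = (\<lambda>a. [a]) ` V_index r n"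
  by (auto simp: words_def length_Suc_conv)

lemma words_2: "Vwords 2 = (\<lambda>(a, b). [a, b]) ` (V_index r n \<times> V_index r n)"
  by (auto simp: words_def length_Suc_conv numeral_2_eq_2 image_iff)

lemma op_T_image_closed:
  "(\<lambda>w. case w of [(i, t)] \<Rightarrow> xi r ^ t \<odot>\<^bsub>V_tensor r n 1\<^esub> v_basis r i t) \<in> Vwords 1 \<rightarrow> carrier (V_tensor r n 1)"
proof
  fix w assume "w \<in> Vwords 1"
  then obtain i t where w: "w = [(i, t)]" "w \<in> Vwords 1"
    by (auto simp: words_1[unfolded One_nat_def])
  then show "(case w of [(i, t)] \<Rightarrow> xi r ^ t \<odot>\<^bsub>V_tensor r n 1\<^esub> v_basis r i t) \<in> carrier (V_tensor r n 1)"
    using V.smult_closed[OF ground_ring_power_closed ebasis_closed] by (simp add: v_basis_def ground_ring_generators)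
qed

lemma op_T_linear: "op_T r n \<in> linear_maps (ground_ring r) (V_tensor r n 1) (V_tensor r n 1)"
  unfolding op_T_def using V.linear_extension_linear[OF op_T_image_closed]
  by (simp add: V_tensor_def tensor_power_def)

lemma op_T_basis:
  assumes "a \<in> V_index r n"
  shows "op_T r n (ebasis [a]) = (\<lambda>p. xi r ^ snd a * ebasis [a] p)"
proof -
  have "[a] \<in> Vwords 1"
    using assms by (auto simp: words_1[unfolded One_nat_def])
  then show ?thesis
    unfolding op_T_def
    by (subst V.linear_extension_basis[OF op_T_image_closed])
      (simp_all add: V_tensor_simps v_basis_def split: prod.splits)
qed

text \<open>The function on words that \<open>op_G\<close> extends linearly, named so that its
  values can be rewritten and shown closed before the extension is used.\<close>

definition op_G_image :: "(nat \<times> nat) list \<Rightarrow> (nat \<times> nat) list \<Rightarrow> scalar"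
  where "op_G_image = (let V2 = V_tensor r n 2; tens = tensor (ground_ring r) in
        (\<lambda>w. case w of [(i, t), (j, s)] \<Rightarrow>
           if t \<noteq> s then tens (v_basis r j s) (v_basis r i t)
           else if i = j then q_var \<odot>\<^bsub>V2\<^esub> tens (v_basis r i t) (v_basis r j s)
           else if i > j then tens (v_basis r j s) (v_basis r i t)
           else (q_var - inverse q_var) \<odot>\<^bsub>V2\<^esub> tens (v_basis r i t) (v_basis r j s) \<oplus>\<^bsub>V2\<^esub>
             tens (v_basis r j s) (v_basis r i t)))"

lemma op_G_image_eq:
  "op_G_image [a, b] = (\<lambda>p. G_diag a b * ebasis [a, b] p + G_swap a b * ebasis [b, a] p)"
  by (cases a; cases b)
    (auto simp: op_G_image_def Let_def v_basis_def tensor_basis_vec R.ring_axioms V_tensor_simps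
      G_diag_def G_swap_def)

lemma op_G_image_closed: "op_G_image \<in> Vwords 2 \<rightarrow> carrier (V_tensor r n 2)"
proof
  fix w assume "w \<in> Vwords 2"
  then obtain a b where w: "w = [a, b]" and "a \<in> V_index r n" "b \<in> V_index r n"
    by (auto simp: words_2)
  then have "[a, b] \<in> Vwords 2" "[b, a] \<in> Vwords 2"
    by (auto simp: words_2)
  then show "op_G_image w \<in> carrier (V_tensor r n 2)"
    unfolding w op_G_image_eq by (intro V_combination_closed ebasis_closed) simp_all
qed

lemma op_G_eq: "op_G r n = linear_extension (ground_ring r) (Vwords 2) (V_tensor r n 2) op_G_image"
  by (simp add: op_G_def op_G_image_def Let_def)

lemma op_G_linear: "op_G r n \<in> linear_maps (ground_ring r) (V_tensor r n 2) (V_tensor r n 2)"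
  unfolding op_G_eq using V.linear_extension_linear[OF op_G_image_closed]
  by (simp add: V_tensor_def tensor_power_def)

lemma op_G_basis:
  assumes "a \<in> V_index r n" "b \<in> V_index r n"
  shows "op_G r n (ebasis [a, b]) = (\<lambda>p. G_diag a b * ebasis [a, b] p + G_swap a b * ebasis [b, a] p)"
proof -
  have "[a, b] \<in> Vwords 2"
    using assms by (auto simp: words_2)
  then show ?thesis
    unfolding op_G_eq by (subst V.linear_extension_basis[OF op_G_image_closed]) (simp_all add: op_G_image_eq)
qed

lemma op_T_at_linear:
  assumes "i \<in> {1..n}"
  shows "op_T_at r n i \<in> linear_maps (ground_ring r) (V_tensor r n n) (V_tensor r n n)"
  using R.act_at_linear[OF op_T_linear[unfolded V_tensor_def], of i n] assms
  by (simp add: op_T_at_def V_tensor_def)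

lemma op_T_at_basis:
  assumes i: "i \<in> {1..n}" and w: "w \<in> Vwords n"
  shows "op_T_at r n i (ebasis w) = (\<lambda>p. xi r ^ snd (w ! (i - 1)) * ebasis w p)"
proof -
  let ?u = "take (i - 1) w" and ?a = "w ! (i - 1)" and ?v = "drop i w"
  have len: "length w = n"
    using w by (simp add: words_def)
  have dec: "w = ?u @ [?a] @ ?v"
    using i id_take_nth_drop[of "i - 1" w] by (simp add: len Suc_diff_Suc less_eq_Suc_le)
  have a: "?a \<in> V_index r n"
    using w i by (auto simp: words_def)
  \<comment> \<open>A zero second term is added to fit the two-term form of
    \<open>act_at_basis\<close>.\<close>
  have "op_T_at r n i (ebasis (?u @ [?a] @ ?v)) =
      (\<lambda>p. xi r ^ snd ?a \<otimes>\<^bsub>ground_ring r\<^esub> ebasis (?u @ [?a] @ ?v) p \<oplus>\<^bsub>ground_ring r\<^esub>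
        \<zero>\<^bsub>ground_ring r\<^esub> \<otimes>\<^bsub>ground_ring r\<^esub> ebasis (?u @ [?a] @ ?v) p)"
    unfolding op_T_at_def
  proof (rule R.act_at_basis[OF op_T_linear[unfolded V_tensor_def]])
    show "op_T r n (ebasis [?a]) = (\<lambda>p. xi r ^ snd ?a \<otimes>\<^bsub>ground_ring r\<^esub> ebasis [?a] p
        \<oplus>\<^bsub>ground_ring r\<^esub> \<zero>\<^bsub>ground_ring r\<^esub> \<otimes>\<^bsub>ground_ring r\<^esub> ebasis [?a] p)"
      using op_T_basis[OF a] by simp
    show "?u @ [?a] @ ?v \<in> Vwords n"
      using w dec by simp
  qed (use i len in \<open>auto simp: ground_ring_generators\<close>)
  then show ?thesis
    using dec by simp
qed

lemma op_G_at_linear: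
  assumes "i \<in> {1..<n}"
  shows "op_G_at r n i \<in> linear_maps (ground_ring r) (V_tensor r n n) (V_tensor r n n)"
  using R.act_at_linear[OF op_G_linear[unfolded V_tensor_def], of i n] assms
  by (simp add: op_G_at_def V_tensor_def)

lemma op_G_at_basis:
  assumes i: "i \<in> {1..<n}" and w: "w \<in> Vwords n"
  shows "op_G_at r n i (ebasis w) =
    (\<lambda>p. G_diag (w ! (i - 1)) (w ! i) * ebasis w p + G_swap (w ! (i - 1)) (w ! i) * ebasis (swap_at i w) p)"
proof -
  let ?u = "take (i - 1) w" and ?a = "w ! (i - 1)" and ?b = "w ! i" and ?v = "drop (i + 1) w"
  have len: "length w = n"
    using w by (simp add: words_def)
  have dec: "w = ?u @ [?a, ?b] @ ?v"
    using i id_take_nth_drop[of "i - 1" w] Cons_nth_drop_Suc[of i w]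
    by (simp add: len Suc_diff_Suc less_eq_Suc_le less_imp_diff_less)
  have swap: "swap_at i w = ?u @ [?b, ?a] @ ?v"
    using i len by (subst (1) dec) (auto simp: swap_at_def list_update_append nth_append min_def Suc_diff_le split: nat.splits)
  have ab: "?a \<in> V_index r n" "?b \<in> V_index r n"
    using w i by (auto simp: words_def)
  have "op_G_at r n i (ebasis (?u @ [?a, ?b] @ ?v)) =
      (\<lambda>p. G_diag ?a ?b \<otimes>\<^bsub>ground_ring r\<^esub> ebasis (?u @ [?a, ?b] @ ?v) p \<oplus>\<^bsub>ground_ring r\<^esub>
        G_swap ?a ?b \<otimes>\<^bsub>ground_ring r\<^esub> ebasis (?u @ [?b, ?a] @ ?v) p)"
    unfolding op_G_at_def
  proof (rule R.act_at_basis[OF op_G_linear[unfolded V_tensor_def]])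
    show "op_G r n (ebasis [?a, ?b]) = (\<lambda>p. G_diag ?a ?b \<otimes>\<^bsub>ground_ring r\<^esub> ebasis [?a, ?b] p
        \<oplus>\<^bsub>ground_ring r\<^esub> G_swap ?a ?b \<otimes>\<^bsub>ground_ring r\<^esub> ebasis [?b, ?a] p)"
      using op_G_basis[OF ab] by simp
    show "?u @ [?a, ?b] @ ?v \<in> Vwords n"
      using w dec by simp
  qed (use i len in auto)
  then show ?thesis
    using dec swap by simp
qed

section \<open>The free algebra acting on the tensor space\<close>

interpretation F: unital_algebra "ground_ring r" "yh_free r n"
  by (rule R.unital_algebra_free_algebra)

abbreviation (input) yh_lift where
  "yh_lift \<equiv> free_algebra_lift (ground_ring r) (yh_generators n) (right_End (ground_ring r) (V_tensor r n n)) (yh_action r n)"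

lemma yh_action_closed: "yh_action r n \<in> yh_generators n \<rightarrow> carrier (right_End (ground_ring r) (V_tensor r n n))"
  by (auto simp: yh_generators_def yh_action_def op_G_at_linear op_T_at_linear)

lemmas yh_lift_hom = unital_algebra.free_algebra_lift_hom[OF V.unital_algebra_right_End yh_action_closed]

lemma yh_lift_ring_hom: "yh_lift \<in> ring_hom (yh_free r n) (right_End (ground_ring r) (V_tensor r n n))"
  using yh_lift_hom unfolding algebra_hom_def by blast

lemma yh_lift_linear: "u \<in> carrier (yh_free r n) \<Longrightarrow> yh_lift u \<in> linear_maps (ground_ring r) (V_tensor r n n) (V_tensor r n n)"
  using ring_hom_closed[OF yh_lift_ring_hom] by simp

text \<open>The product of \<open>right_End\<close> applies its left factor first, so a product of
  generators acts in reading order.\<close>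

lemma yh_lift_mult:
  assumes "u \<in> carrier (yh_free r n)" "v \<in> carrier (yh_free r n)" "x \<in> carrier (V_tensor r n n)"
  shows "yh_lift (u \<otimes>\<^bsub>yh_free r n\<^esub> v) x = yh_lift v (yh_lift u x)"
  using assms by (simp add: ring_hom_mult[OF yh_lift_ring_hom] compose_def)

lemma yh_lift_add:
  assumes "u \<in> carrier (yh_free r n)" "v \<in> carrier (yh_free r n)" "x \<in> carrier (V_tensor r n n)"
  shows "yh_lift (u \<oplus>\<^bsub>yh_free r n\<^esub> v) x = (\<lambda>p. yh_lift u x p + yh_lift v x p)"
  using assms by (simp add: ring_hom_add[OF yh_lift_ring_hom] V_tensor_simps)

lemma yh_lift_smult:
  assumes "a \<in> carrier (ground_ring r)" "u \<in> carrier (yh_free r n)" "x \<in> carrier (V_tensor r n n)"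
  shows "yh_lift (a \<odot>\<^bsub>yh_free r n\<^esub> u) x = (\<lambda>p. a * yh_lift u x p)"
  using yh_lift_hom assms by (simp add: algebra_hom_def V_tensor_simps)

lemma yh_lift_one: "x \<in> carrier (V_tensor r n n) \<Longrightarrow> yh_lift \<one>\<^bsub>yh_free r n\<^esub> x = x"
  by (simp add: ring_hom_one[OF yh_lift_ring_hom])

lemma yh_lift_zero: "x \<in> carrier (V_tensor r n n) \<Longrightarrow> yh_lift \<zero>\<^bsub>yh_free r n\<^esub> x = (\<lambda>p. 0)"
  using yh_lift_smult[of "\<zero>\<^bsub>ground_ring r\<^esub>" "\<zero>\<^bsub>yh_free r n\<^esub>" x] by simp

lemma free_g_closed: "i \<in> {1..<n} \<Longrightarrow> free_g r i \<in> carrier (yh_free r n)"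
  and free_t_closed: "i \<in> {1..n} \<Longrightarrow> free_t r i \<in> carrier (yh_free r n)"
  unfolding free_g_def free_t_def R.free_algebra_simps
  by (intro R.basis_vec_in_free_module; simp add: yh_generators_def)+

lemma yh_lift_g: "i \<in> {1..<n} \<Longrightarrow> yh_lift (free_g r i) = op_G_at r n i"
  and yh_lift_t: "i \<in> {1..n} \<Longrightarrow> yh_lift (free_t r i) = op_T_at r n i"
  using unital_algebra.free_algebra_lift_gen[OF V.unital_algebra_right_End yh_action_closed]
  by (simp_all add: free_g_def free_t_def yh_generators_def yh_action_def)

lemma yh_lift_eqI:
  assumes "u \<in> carrier (yh_free r n)" "v \<in> carrier (yh_free r n)"
    and "\<And>w. w \<in> Vwords n \<Longrightarrow> yh_lift u (ebasis w) = yh_lift v (ebasis w)"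
  shows "yh_lift u = yh_lift v"
proof (rule V.linear_maps_free_eqI[where S = "Vwords n"])
  show "yh_lift u \<in> linear_maps (ground_ring r) (free_module (ground_ring r) (Vwords n)) (V_tensor r n n)"
    and "yh_lift v \<in> linear_maps (ground_ring r) (free_module (ground_ring r) (Vwords n)) (V_tensor r n n)"
    using yh_lift_linear assms by (simp_all add: V_tensor_def tensor_power_def)
qed (use assms in auto)

text \<open>Membership conditions travel with the eigenvalue equation, so the rules below chain
  through the nested expression \<open>free_e\<close> without separate closure arguments.\<close>

definition eigen where
  "eigen u w c \<longleftrightarrow> u \<in> carrier (yh_free r n) \<and> c \<in> carrier (ground_ring r) \<and> w \<in> Vwords n \<and>
    yh_lift u (ebasis w) = (\<lambda>p. c * ebasis w p)"

lemma eigen_t: "i \<in> {1..n} \<Longrightarrow> w \<in> Vwords n \<Longrightarrow> eigen (free_t r i) w (xi r ^ snd (w ! (i - 1)))"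
  by (simp only: eigen_def yh_lift_t op_T_at_basis free_t_closed ground_ring_power_closed ground_ring_generators simp_thms)

lemma eigen_one: "w \<in> Vwords n \<Longrightarrow> eigen \<one>\<^bsub>yh_free r n\<^esub> w 1"
  by (simp add: eigen_def yh_lift_one ebasis_closed)

lemma eigen_mult:
  assumes "eigen u w c" "eigen v w d"
  shows "eigen (u \<otimes>\<^bsub>yh_free r n\<^esub> v) w (c * d)"
proof -
  have "yh_lift (u \<otimes>\<^bsub>yh_free r n\<^esub> v) (ebasis w) = yh_lift v (\<lambda>p. c * ebasis w p)"
    using assms by (simp add: eigen_def yh_lift_mult ebasis_closed)
  also have "\<dots> = (\<lambda>p. c * yh_lift v (ebasis w) p)"
    using assms by (intro linear_smult[where m = n] yh_lift_linear ebasis_closed) (simp_all add: eigen_def)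
  finally show ?thesis
    using assms by (simp add: eigen_def mult.assoc)
qed

lemma eigen_pow: "eigen u w c \<Longrightarrow> eigen (u [^]\<^bsub>yh_free r n\<^esub> (k::nat)) w (c ^ k)"
proof (induction k)
  case 0
  then show ?case
    by (simp add: eigen_one eigen_def[of u])
next
  case (Suc k)
  then show ?case
    using eigen_mult[of "u [^]\<^bsub>yh_free r n\<^esub> k" w "c ^ k" u c] by (simp add: mult.commute)
qed

lemma eigen_smult:
  assumes "a \<in> carrier (ground_ring r)" "eigen u w c"
  shows "eigen (a \<odot>\<^bsub>yh_free r n\<^esub> u) w (a * c)"
  using assms by (simp add: eigen_def yh_lift_smult ebasis_closed mult.assoc)

lemma eigen_sum:
  assumes "finite A" "w \<in> Vwords n" "\<And>s. s \<in> A \<Longrightarrow> eigen (u s) w (c s)"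
  shows "eigen (\<Oplus>\<^bsub>yh_free r n\<^esub>s\<in>A. u s) w (\<Sum>s\<in>A. c s)"
  using assms(1,3)
proof (induction A)
  case empty
  then show ?case
    using \<open>w \<in> Vwords n\<close> by (simp add: eigen_def yh_lift_zero ebasis_closed)
next
  case (insert s A)
  then have u: "u s \<in> carrier (yh_free r n)" "u \<in> A \<rightarrow> carrier (yh_free r n)"
    by (auto simp: eigen_def)
  have IH: "eigen (\<Oplus>\<^bsub>yh_free r n\<^esub>s\<in>A. u s) w (\<Sum>s\<in>A. c s)"
    using insert by simp
  have "eigen (u s \<oplus>\<^bsub>yh_free r n\<^esub> (\<Oplus>\<^bsub>yh_free r n\<^esub>s\<in>A. u s)) w (c s + (\<Sum>s\<in>A. c s))"
    using IH insert.prems[of s] by (simp add: eigen_def yh_lift_add ebasis_closed distrib_right)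
  then show ?case
    using insert u by (simp add: F.finsum_insert)
qed

lemma free_e_closed: "i \<in> {1..<n} \<Longrightarrow> free_e r n i \<in> carrier (yh_free r n)"
  unfolding free_e_def
  by (intro F.smult_closed F.finsum_closed F.m_closed F.nat_pow_closed Pi_I free_t_closed ground_ring_generators) auto

context
  assumes r: "r \<ge> 1"
begin

text \<open>\<open>free_e\<close> is a polynomial in two of the \<open>t\<close>, for which every
  word is an eigenvector; its eigenvalue is the average computed in
  \<open>idempotent_eigenvalue\<close>.\<close>

lemma eigen_idempotent:
  assumes i: "i \<in> {1..<n}" and w: "w \<in> Vwords n"
  shows "eigen (free_e r n i) w (if snd (w ! (i - 1)) = snd (w ! i) then 1 else 0)"
proof -
  have len: "length w = n" and w_set: "set w \<subseteq> V_index r n"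
    using w by (auto simp: words_def)
  have "w ! (i - 1) \<in> V_index r n" "w ! i \<in> V_index r n"
    using i len w_set by (auto intro!: subsetD[OF w_set] nth_mem)
  then have less: "snd (w ! (i - 1)) < r" "snd (w ! i) < r"
    by (auto simp: V_index_def)
  \<comment> \<open>The index \<open>i + 1 - 1\<close> is the list entry read by
    \<open>free_t r (i + 1)\<close>.\<close>
  have "eigen (free_e r n i) w (inverse (of_nat r) * (\<Sum>s<r. (xi r ^ snd (w ! (i - 1))) ^ s *
      ((xi r ^ snd (w ! (i + 1 - 1))) ^ (r - 1)) ^ s))"
    unfolding free_e_def using i w
    by (intro eigen_smult eigen_sum eigen_mult eigen_pow eigen_t ground_ring_generators) auto
  then show ?thesis
    using idempotent_eigenvalue[OF r less] by simp
qed

section \<open>Verification of the defining relations\<close>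

lemma relation_t_power:
  assumes i: "i \<in> {1..n}"
  shows "yh_lift (free_t r i [^]\<^bsub>yh_free r n\<^esub> r) = yh_lift \<one>\<^bsub>yh_free r n\<^esub>"
proof (rule yh_lift_eqI)
  fix w assume w: "w \<in> Vwords n"
  have "(xi r ^ snd (w ! (i - 1))) ^ r = 1"
    using xi_power_self[OF r] by (metis mult.commute power_mult power_one)
  then show "yh_lift (free_t r i [^]\<^bsub>yh_free r n\<^esub> r) (ebasis w) = yh_lift \<one>\<^bsub>yh_free r n\<^esub> (ebasis w)"
    using eigen_pow[OF eigen_t[OF i w], of r] w by (simp add: eigen_def yh_lift_one ebasis_closed)
qed (intro F.nat_pow_closed F.one_closed free_t_closed i)+

lemma relation_t_commute:
  assumes i: "i \<in> {1..n}" and j: "j \<in> {1..n}"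
  shows "yh_lift (free_t r i \<otimes>\<^bsub>yh_free r n\<^esub> free_t r j) = yh_lift (free_t r j \<otimes>\<^bsub>yh_free r n\<^esub> free_t r i)"
proof (rule yh_lift_eqI)
  fix w assume w: "w \<in> Vwords n"
  show "yh_lift (free_t r i \<otimes>\<^bsub>yh_free r n\<^esub> free_t r j) (ebasis w) = yh_lift (free_t r j \<otimes>\<^bsub>yh_free r n\<^esub> free_t r i) (ebasis w)"
    using eigen_mult[OF eigen_t[OF i w] eigen_t[OF j w]] eigen_mult[OF eigen_t[OF j w] eigen_t[OF i w]]
    by (simp add: eigen_def mult.commute)
qed (intro F.m_closed free_t_closed i j)+

text \<open>As rewrite rules these push a product of generators through a basis vector and leave an
  explicit combination of basis vectors.\<close>

lemmas op_rules = yh_lift_mult yh_lift_g yh_lift_t op_G_at_basis op_T_at_basis ebasis_closed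
  linear_combination[OF op_G_at_linear] linear_combination[OF op_T_at_linear]
  linear_smult[OF op_G_at_linear] linear_smult[OF op_T_at_linear]
  linear_maps_closed[OF op_G_at_linear] linear_maps_closed[OF op_T_at_linear]
  V_combination_closed free_g_closed free_t_closed swap_at_words

text \<open>In the exchanged term, place \<open>?k\<close> of the new word carries the letter that
  place \<open>j\<close> had before. The diagonal term keeps the word, but it survives only when the
  upper indices at places \<open>i\<close> and \<open>i + 1\<close> agree, and then places
  \<open>j\<close> and \<open>?k\<close> give the same eigenvalue.\<close>

lemma relation_t_g:
  assumes i: "i \<in> {1..<n}" and j: "j \<in> {1..n}"
  shows "yh_lift (free_t r j \<otimes>\<^bsub>yh_free r n\<^esub> free_g r i) =
    yh_lift (free_g r i \<otimes>\<^bsub>yh_free r n\<^esub> free_t r (transpose i (i + 1) j))"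
proof (rule yh_lift_eqI)
  let ?k = "transpose i (i + 1) j"
  have k: "?k \<in> {1..n}"
    using i j by (auto simp: transpose_def)
  show "free_t r j \<otimes>\<^bsub>yh_free r n\<^esub> free_g r i \<in> carrier (yh_free r n)"
    and "free_g r i \<otimes>\<^bsub>yh_free r n\<^esub> free_t r ?k \<in> carrier (yh_free r n)"
    by (intro F.m_closed free_t_closed free_g_closed i j k)+
  fix w assume w: "w \<in> Vwords n"
  then have len: "length w = n"
    by (simp add: words_def)
  have sw: "swap_at i w \<in> Vwords n"
    using i w by (simp add: swap_at_words)
  let ?a = "w ! (i - 1)" and ?b = "w ! i"
  have "swap_at i w ! (?k - 1) = w ! (j - 1)"
    using i j len by (auto simp: transpose_def nth_swap_at)
  moreover have "snd (w ! (?k - 1)) = snd (w ! (j - 1))" if "snd ?a = snd ?b"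
    using i j that by (auto simp: transpose_def)
  ultimately show "yh_lift (free_t r j \<otimes>\<^bsub>yh_free r n\<^esub> free_g r i) (ebasis w) =
      yh_lift (free_g r i \<otimes>\<^bsub>yh_free r n\<^esub> free_t r ?k) (ebasis w)"
    using i j k w sw G_diag_eq_0[of ?a ?b]
    by (cases "snd ?a = snd ?b")
      (simp_all add: op_rules ground_ring_generators del: atLeastAtMost_iff atLeastLessThan_iff,
        simp_all add: algebra_simps)
qed

text \<open>The two pairs of places are disjoint, so neither exchange affects the letters that
  determine the other's coefficients.\<close>

lemma relation_g_commute:
  assumes i: "i \<in> {1..<n}" and j: "j \<in> {1..<n}" and ij: "\<bar>int i - int j\<bar> > 1"
  shows "yh_lift (free_g r i \<otimes>\<^bsub>yh_free r n\<^esub> free_g r j) = yh_lift (free_g r j \<otimes>\<^bsub>yh_free r n\<^esub> free_g r i)"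
proof (rule yh_lift_eqI)
  fix w assume w: "w \<in> Vwords n"
  then have len: "length w = n"
    by (simp add: words_def)
  have sw: "swap_at i w \<in> Vwords n" "swap_at j w \<in> Vwords n"
    using i j w by (simp_all add: swap_at_words)
  have swap: "swap_at i (swap_at j w) = swap_at j (swap_at i w)"
    using i j ij len by (intro swap_at_commute) auto
  have nth: "swap_at i w ! (j - 1) = w ! (j - 1)" "swap_at i w ! j = w ! j"
    "swap_at j w ! (i - 1) = w ! (i - 1)" "swap_at j w ! i = w ! i"
    using i j ij len by (auto simp: nth_swap_at)
  show "yh_lift (free_g r i \<otimes>\<^bsub>yh_free r n\<^esub> free_g r j) (ebasis w) = yh_lift (free_g r j \<otimes>\<^bsub>yh_free r n\<^esub> free_g r i) (ebasis w)"
    using i j w sw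
    by (simp add: op_rules swap nth[unfolded One_nat_def] del: atLeastAtMost_iff atLeastLessThan_iff)
        (simp add: algebra_simps)
qed (intro F.m_closed free_g_closed i j)+

text \<open>Both sides are expanded over the six rearrangements of the letters at places
  \<open>i\<close>, \<open>i + 1\<close>, \<open>i + 2\<close>. For the words reached by at least
  two exchanges the coefficients agree as written; the remaining three are the
  \<open>G_braid\<close> identities.\<close>

lemma relation_g_braid:
  assumes i: "i \<in> {1..<n}" and i': "i + 1 \<in> {1..<n}"
  shows "yh_lift (free_g r i \<otimes>\<^bsub>yh_free r n\<^esub> free_g r (i + 1) \<otimes>\<^bsub>yh_free r n\<^esub> free_g r i) =
    yh_lift (free_g r (i + 1) \<otimes>\<^bsub>yh_free r n\<^esub> free_g r i \<otimes>\<^bsub>yh_free r n\<^esub> free_g r (i + 1))"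
proof (rule yh_lift_eqI)
  fix w assume w: "w \<in> Vwords n"
  then have len: "length w = n"
    by (simp add: words_def)
  define j where "j = i + 1"
  define a b c where "a = w ! (i - 1)" and "b = w ! i" and "c = w ! j"
  have j: "j \<in> {1..<n}" "j - 1 = i"
    using i' by (simp_all add: j_def)
  let ?s = "swap_at i" and ?t = "swap_at j"
  have sw: "?s w \<in> Vwords n" "?t w \<in> Vwords n" "?t (?s w) \<in> Vwords n" "?s (?t w) \<in> Vwords n"
    using i j w by (simp_all add: swap_at_words)
  \<comment> \<open>The third equation is oriented so that both sides end in the same word
    \<open>?s (?t (?s w))\<close>.\<close>
  have swap: "?s (?s w) = w" "?t (?t w) = w" "?t (?s (?t w)) = ?s (?t (?s w))"
    using i i' len swap_at_braid[of i w] by (simp_all add: swap_at_swap_at j_def)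
  have nth: "w ! (i - 1) = a" "w ! i = b" "w ! j = c"
    "?s w ! (i - 1) = b" "?s w ! i = a" "?s w ! j = c"
    "?t w ! (i - 1) = a" "?t w ! i = c" "?t w ! j = b"
    "?t (?s w) ! (i - 1) = b" "?t (?s w) ! i = c" "?t (?s w) ! j = a"
    "?s (?t w) ! (i - 1) = c" "?s (?t w) ! i = a" "?s (?t w) ! j = b"
    using i i' len by (auto simp: nth_swap_at a_def b_def c_def j_def)
  have "yh_lift (free_g r i \<otimes>\<^bsub>yh_free r n\<^esub> free_g r j \<otimes>\<^bsub>yh_free r n\<^esub> free_g r i) (ebasis w) p =
      yh_lift (free_g r j \<otimes>\<^bsub>yh_free r n\<^esub> free_g r i \<otimes>\<^bsub>yh_free r n\<^esub> free_g r j) (ebasis w) p" for p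
  proof -
    have "yh_lift (free_g r i \<otimes>\<^bsub>yh_free r n\<^esub> free_g r j \<otimes>\<^bsub>yh_free r n\<^esub> free_g r i) (ebasis w) p =
      (G_diag a b * G_diag b c * G_diag a b + G_swap a b * G_diag a c * G_swap b a) * ebasis w p +
      ((G_diag a b * G_diag b c + G_diag a c * G_diag b a) * G_swap a b) * ebasis (?s w) p +
      (G_diag a b * G_swap b c * G_diag a c) * ebasis (?t w) p +
      (G_swap a b * G_swap a c * G_diag b c) * ebasis (?t (?s w)) p +
      (G_diag a b * G_swap b c * G_swap a c) * ebasis (?s (?t w)) p +
      (G_swap a b * G_swap a c * G_swap b c) * ebasis (?s (?t (?s w))) p"
      using i j w sw
      by (simp add: op_rules F.m_closed swap nth[unfolded One_nat_def] j(2)[unfolded One_nat_def] del: atLeastAtMost_iff atLeastLessThan_iff)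
        (simp add: algebra_simps)
    moreover have "yh_lift (free_g r j \<otimes>\<^bsub>yh_free r n\<^esub> free_g r i \<otimes>\<^bsub>yh_free r n\<^esub> free_g r j) (ebasis w) p =
      (G_diag b c * G_diag a b * G_diag b c + G_swap b c * G_diag a c * G_swap c b) * ebasis w p +
      (G_diag b c * G_swap a b * G_diag a c) * ebasis (?s w) p +
      ((G_diag b c * G_diag a b + G_diag a c * G_diag c b) * G_swap b c) * ebasis (?t w) p +
      (G_swap a b * G_swap a c * G_diag b c) * ebasis (?t (?s w)) p +
      (G_diag a b * G_swap b c * G_swap a c) * ebasis (?s (?t w)) p +
      (G_swap a b * G_swap a c * G_swap b c) * ebasis (?s (?t (?s w))) p"
      using i j w sw
      by (simp add: op_rules F.m_closed swap nth[unfolded One_nat_def] j(2)[unfolded One_nat_def] del: atLeastAtMost_iff atLeastLessThan_iff)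
        (simp add: algebra_simps)
    ultimately show ?thesis
      by (simp only: G_braid_identity[of a b c] G_braid_left G_braid_right)
  qed
  then show "yh_lift (free_g r i \<otimes>\<^bsub>yh_free r n\<^esub> free_g r (i + 1) \<otimes>\<^bsub>yh_free r n\<^esub> free_g r i) (ebasis w) =
      yh_lift (free_g r (i + 1) \<otimes>\<^bsub>yh_free r n\<^esub> free_g r i \<otimes>\<^bsub>yh_free r n\<^esub> free_g r (i + 1)) (ebasis w)"
    unfolding j_def by (rule ext)
qed (intro F.m_closed free_g_closed i i')+

text \<open>In \<open>e_i g_i\<close> the factor \<open>e_i\<close> acts first, directly on the
  basis word, where it is the scalar \<open>d\<close>. What remains is a comparison of the
  coefficients of \<open>w\<close> and of the exchanged word.\<close>

lemma relation_g_quadratic: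
  assumes i: "i \<in> {1..<n}"
  shows "yh_lift (free_g r i [^]\<^bsub>yh_free r n\<^esub> (2::nat)) =
    yh_lift (\<one>\<^bsub>yh_free r n\<^esub> \<oplus>\<^bsub>yh_free r n\<^esub> (q_var - inverse q_var) \<odot>\<^bsub>yh_free r n\<^esub>
      (free_e r n i \<otimes>\<^bsub>yh_free r n\<^esub> free_g r i))"
proof (rule yh_lift_eqI)
  have q: "q_var - inverse q_var \<in> carrier (ground_ring r)"
    by (simp add: ground_ring_generators)
  show "\<one>\<^bsub>yh_free r n\<^esub> \<oplus>\<^bsub>yh_free r n\<^esub> (q_var - inverse q_var) \<odot>\<^bsub>yh_free r n\<^esub>
      (free_e r n i \<otimes>\<^bsub>yh_free r n\<^esub> free_g r i) \<in> carrier (yh_free r n)"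
    using i q by (intro F.add.m_closed F.smult_closed F.m_closed F.one_closed free_e_closed free_g_closed)
  fix w assume w: "w \<in> Vwords n"
  then have len: "length w = n"
    by (simp add: words_def)
  define a b where "a = w ! (i - 1)" and "b = w ! i"
  define d :: scalar where "d = (if snd a = snd b then 1 else 0)"
  have sw: "swap_at i w \<in> Vwords n" and swap: "swap_at i (swap_at i w) = w"
    and nth: "w ! (i - 1) = a" "w ! i = b" "swap_at i w ! (i - 1) = b" "swap_at i w ! i = a"
    using i w len by (auto simp: swap_at_words swap_at_swap_at nth_swap_at a_def b_def)
  have d: "d \<in> carrier (ground_ring r)" and idem: "yh_lift (free_e r n i) (ebasis w) = (\<lambda>p. d * ebasis w p)"
    using eigen_idempotent[OF i w] by (simp_all add: eigen_def d_def a_def b_def)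
  have sq: "yh_lift (free_g r i \<otimes>\<^bsub>yh_free r n\<^esub> free_g r i) (ebasis w) p =
      (G_diag a b * G_diag a b + G_swap a b * G_swap b a) * ebasis w p +
      (G_diag a b * G_swap a b + G_swap a b * G_diag b a) * ebasis (swap_at i w) p" for p
    using i w sw
    by (simp add: op_rules swap nth[unfolded One_nat_def] del: atLeastAtMost_iff atLeastLessThan_iff)
        (simp add: algebra_simps)
  have coeffs: "(G_diag a b * G_diag a b + G_swap a b * G_swap b a) * ebasis w p +
      (G_diag a b * G_swap a b + G_swap a b * G_diag b a) * ebasis (swap_at i w) p =
      ebasis w p + (q_var - inverse q_var) * (d * (G_diag a b * ebasis w p + G_swap a b * ebasis (swap_at i w) p))" for p
    unfolding G_quadratic_diag G_quadratic_swap d_def by (simp only: algebra_simps mult_1)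
  have rhs: "yh_lift (\<one>\<^bsub>yh_free r n\<^esub> \<oplus>\<^bsub>yh_free r n\<^esub> (q_var - inverse q_var) \<odot>\<^bsub>yh_free r n\<^esub>
      (free_e r n i \<otimes>\<^bsub>yh_free r n\<^esub> free_g r i)) (ebasis w) p =
      ebasis w p + (q_var - inverse q_var) * (d * (G_diag a b * ebasis w p + G_swap a b * ebasis (swap_at i w) p))" for p
    using i w sw q d
    by (simp add: op_rules yh_lift_add yh_lift_smult yh_lift_one idem nth[unfolded One_nat_def] F.m_closed free_e_closed F.smult_closed F.one_closed
        del: atLeastAtMost_iff atLeastLessThan_iff)
  show "yh_lift (free_g r i [^]\<^bsub>yh_free r n\<^esub> (2::nat)) (ebasis w) =
      yh_lift (\<one>\<^bsub>yh_free r n\<^esub> \<oplus>\<^bsub>yh_free r n\<^esub> (q_var - inverse q_var) \<odot>\<^bsub>yh_free r n\<^esub>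
        (free_e r n i \<otimes>\<^bsub>yh_free r n\<^esub> free_g r i)) (ebasis w)"
    using i by (simp add: numeral_2_eq_2 free_g_closed fun_eq_iff sq coeffs rhs del: atLeastLessThan_iff)
qed (intro F.nat_pow_closed free_g_closed i)

text \<open>Ensures that the relations generate a two-sided ideal of the free algebra. The
  transposed index remains in \<open>{1..n}\<close> because \<open>i < n\<close>.\<close>

lemma yh_relations_closed:
  "yh_relations r n \<subseteq> carrier (yh_free r n) \<times> carrier (yh_free r n)"
proof -
  have t: "transpose i (i + 1) j \<in> {1..n}" if "i \<in> {1..<n}" "j \<in> {1..n}" for i j
    using that by (auto simp: transpose_def)
  have q: "q_var - inverse q_var \<in> carrier (ground_ring r)"
    by (simp add: ground_ring_generators)
  show ?thesis
    unfolding yh_relations_def Let_def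
    by (intro subsetI, elim UnE CollectE exE conjE; hypsubst; intro SigmaI F.m_closed F.nat_pow_closed
        F.one_closed F.add.m_closed F.smult_closed free_t_closed free_g_closed free_e_closed t q; assumption)
qed

lemma yh_relations_hold:
  assumes "(u, v) \<in> yh_relations r n"
  shows "yh_lift u = yh_lift v"
  by (insert assms, unfold yh_relations_def Let_def)
    (elim UnE CollectE exE conjE Pair_inject; hypsubst; intro relation_t_power relation_t_commute
      relation_t_g relation_g_commute relation_g_braid relation_g_quadratic; assumption)

lemma right_representation_exists:
  "\<exists>\<rho>. right_representation (ground_ring r) (yokonuma_hecke r n) (V_tensor r n n) \<rho> \<and>
    (\<forall>i\<in>{1..n}. \<rho> (yh_t r n i) = op_T_at r n i) \<and>
    (\<forall>i\<in>{1..n - 1}. \<rho> (yh_g r n i) = op_G_at r n i)"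
proof -
  obtain \<rho> where \<rho>: "\<rho> \<in> algebra_hom (ground_ring r) (yokonuma_hecke r n)
      (right_End (ground_ring r) (V_tensor r n n))"
    and gen: "\<And>x. x \<in> yh_generators n \<Longrightarrow>
      \<rho> (presented_gen (ground_ring r) (yh_generators n) (yh_relations r n) x) = yh_action r n x"
    using R.presented_algebra_lift[OF yh_relations_closed V.unital_algebra_right_End yh_action_closed
        yh_relations_hold]
    unfolding yokonuma_hecke_def by blast
  have "unital_algebra (ground_ring r) (yokonuma_hecke r n)"
    unfolding yokonuma_hecke_def by (rule R.unital_algebra_presented_algebra[OF yh_relations_closed])
  then have "right_representation (ground_ring r) (yokonuma_hecke r n) (V_tensor r n n) \<rho>"
    by (intro right_representation.intro V.module_axioms right_representation_axioms.intro \<rho>)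
  moreover have "\<rho> (yh_t r n i) = op_T_at r n i" if "i \<in> {1..n}" for i
    using that gen[of "gen_t i"] by (simp add: yh_t_def yh_generators_def yh_action_def)
  moreover have "\<rho> (yh_g r n i) = op_G_at r n i" if "i \<in> {1..n - 1}" for i
    using that gen[of "gen_g i"] by (auto simp: yh_g_def yh_generators_def yh_action_def)
  ultimately show ?thesis
    by blast
qed

end

end

theorem theorem8:
  fixes n r :: nat
  assumes "n \<ge> 1" and "r \<ge> 1"
  shows "\<exists>\<rho>. right_representation (ground_ring r) (yokonuma_hecke r n) (V_tensor r n n) \<rho> \<and>
    (\<forall>i\<in>{1..n}. \<rho> (yh_t r n i) = op_T_at r n i) \<and>
    (\<forall>i\<in>{1..n - 1}. \<rho> (yh_g r n i) = op_G_at r n i)"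
  using assms(2) by (rule right_representation_exists)

end
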